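(* Let $M(B_n)$ denote the number of perfect matchings of the graph $B_n$. For $n\geq31$ we have $$ M(B_n)=3^{4x_n}M(B_{n-30}), $$ where $x_{5k+1}=4k-12$, $x_{5k+2}=4k-10$ and $x_{5k+3}=x_{5k+4}=x_{5k+5}=4k-8$, for $k\geq6$.
   Context: For $n\ge1$, the Aztec diamond graph $AD_n$ has vertices $u_{i,j}$ ($0\le i\le n$, $1\le j\le n$) and $v_{i,j}$ ($1\le i\le n$, $0\le j\le n$), and $4n^2$ edges $\epsilon_{r,s}$, $1\le r,s\le 2n$ (the edge centers form a $2n\times2n$ array), where for $1\le i,j\le n$: $\epsilon_{2i-1,2j-1}=u_{i-1,j}v_{i,j-1}$, $\epsilon_{2i-1,2j}=u_{i-1,j}v_{i,j}$, $\epsilon_{2i,2j-1}=u_{i,j}v_{i,j-1}$, $\epsilon_{2i,2j}=u_{i,j}v_{i,j}$. Let $A$ be the $20\times20$ $0$-$1$ matrix whose rows $1,\dots,20$ are (entries written as strings of digits): 1: 11110101010101011111; 2: 10101111111110101010; 3: 11010101010101111111; 4: 10111111111010101010; 5: 01010101010111111111; 6: 11111111101010101010; 7: 01010101011111111101; 8: 11111110101010101011; 9: 01010101111111110101; 10: 11111010101010101111; 11: 01010111111111010101; 12: 11101010101010111111; 13: 01011111111101010101; 14: 10101010101011111111; 15: 01111111110101010101; 16: 10101010101111111110; 17: 11111111010101010101; 18: 10101010111111111010; 19: 11111101010101010111; 20: 10101011111111101010. (Each row $i+2$ is row $i$ cyclically shifted two places to the left, indices modulo $20$.) $B_n$ is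 the spanning subgraph of $AD_n$ consisting of those edges $\epsilon_{r,s}$ for which the entry of $A$ in row $r'$ and column $s'$ is $1$, where $1\le r',s'\le20$, $r'\equiv r$, $s'\equiv s\pmod{20}$. *)

theory Defs
  imports Main "HOL-Number_Theory.Cong"
begin

text \<open>A finite simple graph is a pair of a vertex set and a set of two-element edges.\<close>

type_synonym 'v graph = "'v set \<times> 'v set set"

definition perfect_matching :: "'v graph \<Rightarrow> 'v set set \<Rightarrow> bool" where
  "perfect_matching G M \<longleftrightarrow> M \<subseteq> snd G \<and> (\<forall>v\<in>fst G. \<exists>!e. e \<in> M \<and> v \<in> e)"

definition num_perfect_matchings :: "'v graph \<Rightarrow> nat" where
  "num_perfect_matchings G = card {M. perfect_matching G M}"

datatype aztec_vertex = U nat nat | V nat nat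

definition aztec_vertices :: "nat \<Rightarrow> aztec_vertex set" where
  "aztec_vertices n =
     {U i j | i j. 0 \<le> i \<and> i \<le> n \<and> 1 \<le> j \<and> j \<le> n} \<union>
     {V i j | i j. 1 \<le> i \<and> i \<le> n \<and> 0 \<le> j \<and> j \<le> n}"

text \<open>
  The four parity cases for the edge in position \<open>(r, s)\<close> in one formula; they are
  separated in \<open>aztec_edge_cases\<close> below.
\<close>

definition aztec_edge :: "nat \<Rightarrow> nat \<Rightarrow> aztec_vertex set" where
  "aztec_edge r s = {U (r div 2) ((s + 1) div 2), V ((r + 1) div 2) (s div 2)}"

lemma aztec_edge_cases:
  assumes "1 \<le> i" "1 \<le> j"
  shows "aztec_edge (2 * i - 1) (2 * j - 1) = {U (i - 1) j, V i (j - 1)}"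
    and "aztec_edge (2 * i - 1) (2 * j) = {U (i - 1) j, V i j}"
    and "aztec_edge (2 * i) (2 * j - 1) = {U i j, V i (j - 1)}"
    and "aztec_edge (2 * i) (2 * j) = {U i j, V i j}"
proof -
  have "(2 * i - 1) div 2 = i - 1" "(2 * j - 1) div 2 = j - 1"
    using assms by presburger+
  then show "aztec_edge (2 * i - 1) (2 * j - 1) = {U (i - 1) j, V i (j - 1)}"
    and "aztec_edge (2 * i - 1) (2 * j) = {U (i - 1) j, V i j}"
    and "aztec_edge (2 * i) (2 * j - 1) = {U i j, V i (j - 1)}"
    and "aztec_edge (2 * i) (2 * j) = {U i j, V i j}"
    using assms by (simp_all add: aztec_edge_def)
qed

definition aztec_diamond :: "nat \<Rightarrow> aztec_vertex graph" where
  "aztec_diamond n =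
     (aztec_vertices n, {aztec_edge r s | r s. r \<in> {1..2 * n} \<and> s \<in> {1..2 * n}})"

definition A_rows :: "nat list list" where
  "A_rows =
  [[1,1,1,1,0,1,0,1,0,1,0,1,0,1,0,1,1,1,1,1],
   [1,0,1,0,1,1,1,1,1,1,1,1,1,0,1,0,1,0,1,0],
   [1,1,0,1,0,1,0,1,0,1,0,1,0,1,1,1,1,1,1,1],
   [1,0,1,1,1,1,1,1,1,1,1,0,1,0,1,0,1,0,1,0],
   [0,1,0,1,0,1,0,1,0,1,0,1,1,1,1,1,1,1,1,1],
   [1,1,1,1,1,1,1,1,1,0,1,0,1,0,1,0,1,0,1,0],
   [0,1,0,1,0,1,0,1,0,1,1,1,1,1,1,1,1,1,0,1],
   [1,1,1,1,1,1,1,0,1,0,1,0,1,0,1,0,1,0,1,1],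
   [0,1,0,1,0,1,0,1,1,1,1,1,1,1,1,1,0,1,0,1],
   [1,1,1,1,1,0,1,0,1,0,1,0,1,0,1,0,1,1,1,1],
   [0,1,0,1,0,1,1,1,1,1,1,1,1,1,0,1,0,1,0,1],
   [1,1,1,0,1,0,1,0,1,0,1,0,1,0,1,1,1,1,1,1],
   [0,1,0,1,1,1,1,1,1,1,1,1,0,1,0,1,0,1,0,1],
   [1,0,1,0,1,0,1,0,1,0,1,0,1,1,1,1,1,1,1,1],
   [0,1,1,1,1,1,1,1,1,1,0,1,0,1,0,1,0,1,0,1],
   [1,0,1,0,1,0,1,0,1,0,1,1,1,1,1,1,1,1,1,0],
   [1,1,1,1,1,1,1,1,0,1,0,1,0,1,0,1,0,1,0,1],
   [1,0,1,0,1,0,1,0,1,1,1,1,1,1,1,1,1,0,1,0],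
   [1,1,1,1,1,1,0,1,0,1,0,1,0,1,0,1,0,1,1,1],
   [1,0,1,0,1,0,1,1,1,1,1,1,1,1,1,0,1,0,1,0]]"

text \<open>Entries are indexed from 1, so \<open>A_entry r s\<close> is meant for \<open>r, s \<in> {1..20}\<close>.\<close>

definition A_entry :: "nat \<Rightarrow> nat \<Rightarrow> nat" where
  "A_entry r s = A_rows ! (r - 1) ! (s - 1)"

lemma A_rows_shape: "length A_rows = 20" "\<forall>row \<in> set A_rows. length row = 20"
  by (simp_all add: A_rows_def)

text \<open>Row \<open>i + 2\<close> is row \<open>i\<close> shifted two places to the left, with indices modulo 20.\<close>

lemma A_rows_shift: "rotate 2 A_rows = map (rotate 2) A_rows"
  by (simp add: A_rows_def numeral_2_eq_2)

definition B_graph :: "nat \<Rightarrow> aztec_vertex graph" where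
  "B_graph n =
     (aztec_vertices n,
      {aztec_edge r s | r s. r \<in> {1..2 * n} \<and> s \<in> {1..2 * n} \<and>
         (\<exists>r' \<in> {1..20}. \<exists>s' \<in> {1..20}.
            [r' = r] (mod 20) \<and> [s' = s] (mod 20) \<and> A_entry r' s' = 1)})"

lemma aztec_diamond_edges_wf:
  assumes "e \<in> snd (aztec_diamond n)"
  shows "e \<subseteq> fst (aztec_diamond n)" and "card e = 2"
  using assms by (auto simp: aztec_diamond_def aztec_vertices_def aztec_edge_def)

lemma aztec_index_eq:
  fixes r r' :: nat
  assumes "r div 2 = r' div 2" "(r + 1) div 2 = (r' + 1) div 2"
  shows "r = r'"
proof -
  have "r div 2 + (r + 1) div 2 = r" for r :: nat by presburger
  then show ?thesis using assms by metis
qed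

lemma card_aztec_diamond_edges: "card (snd (aztec_diamond n)) = 4 * n ^ 2"
proof -
  have "inj_on (\<lambda>(r, s). aztec_edge r s) ({1..2 * n} \<times> {1..2 * n})"
  proof (rule inj_onI, clarify)
    fix r s r' s' assume "aztec_edge r s = aztec_edge r' s'"
    then have "r div 2 = r' div 2 \<and> (r + 1) div 2 = (r' + 1) div 2"
      "s div 2 = s' div 2 \<and> (s + 1) div 2 = (s' + 1) div 2"
      by (auto simp: aztec_edge_def doubleton_eq_iff)
    then show "r = r' \<and> s = s'" by (auto dest: aztec_index_eq)
  qed
  moreover have "snd (aztec_diamond n) = (\<lambda>(r, s). aztec_edge r s) ` ({1..2 * n} \<times> {1..2 * n})"
    by (force simp: aztec_diamond_def image_iff)
  ultimately show ?thesis by (simp add: card_image power2_eq_square)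
qed

lemma B_graph_spanning:
  "fst (B_graph n) = fst (aztec_diamond n)" "snd (B_graph n) \<subseteq> snd (aztec_diamond n)"
  by (auto simp: B_graph_def aztec_diamond_def)

lemma finite_perfect_matchings_B: "finite {M. perfect_matching (B_graph n) M}"
proof -
  have "snd (B_graph n) \<subseteq> (\<lambda>(r, s). aztec_edge r s) ` ({1..2 * n} \<times> {1..2 * n})"
    unfolding B_graph_def by auto
  then have "finite (snd (B_graph n))"
    by (rule finite_subset) simp
  moreover have "{M. perfect_matching (B_graph n) M} \<subseteq> Pow (snd (B_graph n))"
    by (auto simp: perfect_matching_def)
  ultimately show ?thesis
    by (meson finite_Pow_iff finite_subset)
qed

text \<open>
  The exponents \<open>x\<^sub>n\<close>, used only for \<open>n \<ge> 31\<close>, where the natural-number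
  subtractions are exact (see \<open>x_exp_values\<close>).
\<close>

definition x_exp :: "nat \<Rightarrow> nat" where
  "x_exp n =
     (let k = (n - 1) div 5 in
      if n mod 5 = 1 then 4 * k - 12 else if n mod 5 = 2 then 4 * k - 10 else 4 * k - 8)"

lemma x_exp_values:
  assumes "k \<ge> 6"
  shows "int (x_exp (5 * k + 1)) = 4 * int k - 12"
    and "int (x_exp (5 * k + 2)) = 4 * int k - 10"
    and "int (x_exp (5 * k + 3)) = 4 * int k - 8"
    and "int (x_exp (5 * k + 4)) = 4 * int k - 8"
    and "int (x_exp (5 * k + 5)) = 4 * int k - 8"
proof -
  have d: "(5 * k + 4) div 5 = k" by presburger
  have m: "(5 * k + 1) mod 5 = 1" "(5 * k + 2) mod 5 = 2" "(5 * k + 3) mod 5 = 3"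
    "(5 * k + 4) mod 5 = 4" "(5 * k + 5) mod 5 = 0" by presburger+
  show "int (x_exp (5 * k + 1)) = 4 * int k - 12"
    and "int (x_exp (5 * k + 2)) = 4 * int k - 10"
    and "int (x_exp (5 * k + 3)) = 4 * int k - 8"
    and "int (x_exp (5 * k + 4)) = 4 * int k - 8"
    and "int (x_exp (5 * k + 5)) = 4 * int k - 8"
    using assms unfolding x_exp_def Let_def m by (simp_all add: d)
qed

end

theory Submission
  imports Defs Complex_Main "HOL-Library.FuncSet" "HOL-Library.Disjoint_Sets"
begin

text \<open>
  A perfect matching of the Aztec diamond distributes the vertices over the \<open>n\<^sup>2\<close> four-cycles
  (cells). If every cell passes from the set of vertices it covers to the complement, and the
  weights of opposite edges \<open>a, d\<close> and \<open>b, c\<close> of the cell are exchanged and divided by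
  \<open>\<Delta> = a d + b c\<close>, then the weighted sum of each cell is divided by \<open>\<Delta>\<close>, interior vertices are still
  covered once, and boundary vertices are no longer covered. So the weighted sum of order \<open>n\<close> is
  the product of the \<open>\<Delta>\<close> times a weighted sum of order \<open>n - 1\<close>.

  The weights of \<open>B\<^sub>n\<close> depend only on \<open>i + j\<close> modulo 10 for the cell \<open>(i, j)\<close>, and up to rescaling at
  the vertices the antidiagonal edges of all cells keep weight 1. The state is then given by four
  consecutive nonzero weights \<open>a\<close> and four consecutive nonzero weights \<open>d\<close>, which are
  those of \<open>a\<close> in reverse order. Each step moves the \<open>d\<close> by two places, so they return after five steps, having
  passed through the \<open>a\<close>. This sweep is an explicit rational map on four numbers, whose sixth
  iterate fixes \<open>(1, 1, 1, 1)\<close> up to rescaling; collecting the factors \<open>\<Delta>\<close> of the thirty steps gives the power of 3.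
\<close>

section \<open>Weighted sums over perfect matchings\<close>

text \<open>The family is indexed, not a set of sets, so that the same notion serves for edges with
  their ends and for cells with the vertex sets assigned to them, several of which may be
  empty.\<close>

definition covers :: "('e \<Rightarrow> 'v set) \<Rightarrow> 'e set \<Rightarrow> 'v set \<Rightarrow> bool" where
  "covers f M X \<longleftrightarrow> disjoint_family_on f M \<and> (\<Union>e\<in>M. f e) = X"

text \<open>An edge with an end outside \<open>X\<close> occurs in no \<open>M\<close> of the sum,
  so vertices can be deleted by shrinking \<open>X\<close> while \<open>E\<close> stays
  fixed.\<close>

definition matching_sum ::
    "('e \<Rightarrow> 'v set) \<Rightarrow> 'e set \<Rightarrow> 'v set \<Rightarrow> ('e \<Rightarrow> 'a) \<Rightarrow> 'a :: field" where
  "matching_sum f E X w = (\<Sum>M | M \<subseteq> E \<and> covers f M X. \<Prod>e\<in>M. w e)"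

text \<open>Counts at a vertex add up over complementary choices, so this form of exact covering is
  the one suited to complementation.\<close>

lemma covers_iff_card:
  assumes "finite M"
  shows "covers f M X \<longleftrightarrow> (\<forall>x. card {e \<in> M. x \<in> f e} = of_bool (x \<in> X))"
proof
  assume c: "covers f M X"
  show "\<forall>x. card {e \<in> M. x \<in> f e} = of_bool (x \<in> X)"
  proof
    fix x
    show "card {e \<in> M. x \<in> f e} = of_bool (x \<in> X)"
    proof (cases "x \<in> X")
      case True
      then obtain e where e: "e \<in> M" "x \<in> f e" using c by (auto simp: covers_def)
      then have "{e \<in> M. x \<in> f e} = {e}"
        using c by (auto simp: covers_def disjoint_family_on_def)
      then show ?thesis using True by simp
    next
      case False
      then have none: "{e \<in> M. x \<in> f e} = {}" using c by (auto simp: covers_def)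
      show ?thesis unfolding none using False by simp
    qed
  qed
next
  assume c: "\<forall>x. card {e \<in> M. x \<in> f e} = of_bool (x \<in> X)"
  have "x \<in> X \<longleftrightarrow> (\<exists>e\<in>M. x \<in> f e)" for x
  proof -
    have "card {e \<in> M. x \<in> f e} = 0 \<longleftrightarrow> {e \<in> M. x \<in> f e} = {}"
      using assms by simp
    then show ?thesis using c[rule_format, of x] by (cases "x \<in> X") auto
  qed
  moreover have "e = e'" if "e \<in> M" "e' \<in> M" "x \<in> f e" "x \<in> f e'" for e e' x
  proof (rule ccontr)
    assume "e \<noteq> e'"
    then have "card {e, e'} = 2" by simp
    moreover have "card {e, e'} \<le> card {e \<in> M. x \<in> f e}"
      using that assms by (intro card_mono) auto
    moreover have "card {e \<in> M. x \<in> f e} \<le> 1" using c by simp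
    ultimately show False by linarith
  qed
  ultimately show "covers f M X"
    unfolding covers_def disjoint_family_on_def by blast
qed

lemma matching_sum_empty: "matching_sum f {} X w = (if X = {} then 1 else 0)"
proof -
  have "{M. M \<subseteq> {} \<and> covers f M X} = (if X = {} then {{}} else {})"
    by (auto simp: covers_def disjoint_family_on_def)
  then show ?thesis by (simp add: matching_sum_def)
qed

text \<open>Split by whether \<open>e\<close> is chosen; if it is, the other edges must cover
  exactly \<open>X - f e\<close>. Repeated use evaluates the sum over any explicit edge set.\<close>

lemma matching_sum_insert:
  assumes "finite E" "e \<notin> E" "f e \<noteq> {}"
  shows "matching_sum f (insert e E) X w = matching_sum f E X w +
    (if f e \<subseteq> X then w e * matching_sum f E (X - f e) w else 0)"
proof -
  let ?P = "\<lambda>E X. {M. M \<subseteq> E \<and> covers f M X}"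
  let ?Q = "if f e \<subseteq> X then insert e ` ?P E (X - f e) else {}"
  have fin: "finite (?P E Y)" for Y
    using assms(1) by (auto intro: finite_subset[of _ "Pow E"])
  have cov: "covers f (insert e M) X \<longleftrightarrow> f e \<subseteq> X \<and> covers f M (X - f e)" if "M \<subseteq> E" for M
  proof -
    have "e \<notin> M" using that assms by auto
    then show ?thesis
      unfolding covers_def disjoint_family_on_insert[OF \<open>e \<notin> M\<close>] by auto
  qed
  have "?P (insert e E) X = ?P E X \<union> ?Q"
  proof (rule set_eqI)
    fix M
    show "M \<in> ?P (insert e E) X \<longleftrightarrow> M \<in> ?P E X \<union> ?Q"
    proof (cases "e \<in> M")
      case True
      have "M \<in> ?P (insert e E) X \<longleftrightarrow> M - {e} \<subseteq> E \<and> covers f (insert e (M - {e})) X"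
        using True by (auto simp: insert_absorb)
      also have "\<dots> \<longleftrightarrow> M - {e} \<subseteq> E \<and> f e \<subseteq> X \<and> covers f (M - {e}) (X - f e)"
        using cov by blast
      also have "\<dots> \<longleftrightarrow> M \<in> ?Q"
      proof
        assume *: "M - {e} \<subseteq> E \<and> f e \<subseteq> X \<and> covers f (M - {e}) (X - f e)"
        then have "M = insert e (M - {e})" using True by auto
        then show "M \<in> ?Q" using * by (auto intro!: image_eqI[of M _ "M - {e}"])
      next
        assume "M \<in> ?Q"
        then obtain N where "f e \<subseteq> X" "M = insert e N" "N \<subseteq> E" "covers f N (X - f e)"
          by (auto split: if_splits)
        moreover have "M - {e} = N" using calculation assms(2) by auto
        ultimately show "M - {e} \<subseteq> E \<and> f e \<subseteq> X \<and> covers f (M - {e}) (X - f e)" by simp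
      qed
      finally show ?thesis using True assms(2) by auto
    next
      case False
      then show ?thesis by auto
    qed
  qed
  moreover have "?P E X \<inter> ?Q = {}" using assms(2) by auto
  ultimately have "matching_sum f (insert e E) X w =
      matching_sum f E X w + (\<Sum>M\<in>?Q. \<Prod>e\<in>M. w e)"
    unfolding matching_sum_def using fin by (subst sum.union_disjoint[symmetric]) auto
  moreover have "(\<Sum>M\<in>insert e ` ?P E Y. \<Prod>e\<in>M. w e) = w e * matching_sum f E Y w" for Y
  proof -
    have "inj_on (insert e) (?P E Y)" using assms(2) by (auto intro!: inj_onI)
    then have "(\<Sum>M\<in>insert e ` ?P E Y. \<Prod>e\<in>M. w e) = (\<Sum>M\<in>?P E Y. \<Prod>e\<in>insert e M. w e)"
      by (simp add: sum.reindex)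
    also have "\<dots> = (\<Sum>M\<in>?P E Y. w e * (\<Prod>e\<in>M. w e))"
    proof (rule sum.cong[OF refl])
      fix M assume "M \<in> ?P E Y"
      then have "finite M" "e \<notin> M" using assms finite_subset by auto
      then show "(\<Prod>e\<in>insert e M. w e) = w e * (\<Prod>e\<in>M. w e)" by simp
    qed
    finally show ?thesis by (simp add: matching_sum_def sum_distrib_left)
  qed
  ultimately show ?thesis by simp
qed

lemma matching_sum_restrict:
  "matching_sum f E X w = matching_sum f {e \<in> E. f e \<subseteq> X} X w"
  unfolding matching_sum_def by (rule sum.cong) (auto simp: covers_def)

text \<open>A covering meets every vertex of \<open>X\<close> in exactly one edge, so each
  \<open>g x\<close> is collected once, whatever the covering.\<close>

lemma matching_sum_gauge:
  assumes "finite E" "\<And>e. e \<in> E \<Longrightarrow> finite (f e)"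
  shows "matching_sum f E X (\<lambda>e. w e * (\<Prod>x\<in>f e. g x)) = (\<Prod>x\<in>X. g x) * matching_sum f E X w"
proof -
  have "(\<Prod>e\<in>M. w e * (\<Prod>x\<in>f e. g x)) = (\<Prod>x\<in>X. g x) * (\<Prod>e\<in>M. w e)"
    if "M \<subseteq> E" "covers f M X" for M
  proof -
    have "finite M" using that assms finite_subset by blast
    then have "(\<Prod>x\<in>(\<Union>e\<in>M. f e). g x) = (\<Prod>e\<in>M. \<Prod>x\<in>f e. g x)"
      using that assms by (intro prod.UNION_disjoint) (auto simp: covers_def disjoint_family_on_def)
    then show ?thesis using that by (simp add: prod.distrib covers_def)
  qed
  then show ?thesis by (simp add: matching_sum_def sum_distrib_left)
qed

lemma matching_sum_cong:
  assumes "\<And>e. e \<in> E \<Longrightarrow> w e = w' e"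
  shows "matching_sum f E X w = matching_sum f E X w'"
  unfolding matching_sum_def using assms by (intro sum.cong prod.cong) auto

lemma matching_sum_reindex:
  assumes "inj_on \<psi> E" "inj \<phi>" "\<And>e. e \<in> E \<Longrightarrow> f (\<psi> e) = \<phi> ` g e"
  shows "matching_sum f (\<psi> ` E) (\<phi> ` X) w = matching_sum g E X (\<lambda>e. w (\<psi> e))"
proof -
  have cov: "covers f (\<psi> ` M) (\<phi> ` X) \<longleftrightarrow> covers g M X" if "M \<subseteq> E" for M
  proof -
    have "(\<Union>e\<in>\<psi> ` M. f e) = \<phi> ` (\<Union>e\<in>M. g e)"
      using that assms(3) by (simp add: image_UN) (auto simp: subset_iff)
    moreover have "disjoint_family_on f (\<psi> ` M) \<longleftrightarrow> disjoint_family_on g M"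
    proof -
      have inj: "\<psi> a = \<psi> b \<longleftrightarrow> a = b" if "a \<in> M" "b \<in> M" for a b
        using inj_onD[OF assms(1), of a b] that \<open>M \<subseteq> E\<close> by blast
      have "f (\<psi> a) \<inter> f (\<psi> b) = \<phi> ` (g a \<inter> g b)" if "a \<in> M" "b \<in> M" for a b
        using that \<open>M \<subseteq> E\<close> assms by (simp add: image_Int subset_iff)
      then show ?thesis using inj
        by (simp add: disjoint_family_on_def)
    qed
    ultimately show ?thesis
      by (simp add: covers_def inj_image_eq_iff[OF assms(2)])
  qed
  have "{M. M \<subseteq> \<psi> ` E \<and> covers f M (\<phi> ` X)} = (`) \<psi> ` {M. M \<subseteq> E \<and> covers g M X}"
    using cov by (auto simp: subset_image_iff)
  moreover have "inj_on ((`) \<psi>) {M. M \<subseteq> E \<and> covers g M X}"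
    using assms(1) by (auto intro!: inj_onI dest: inj_on_image_eq_iff)
  moreover have "(\<Prod>e\<in>\<psi> ` M. w e) = (\<Prod>e\<in>M. w (\<psi> e))" if "M \<subseteq> E" for M
    using prod.reindex[of \<psi> M w] inj_on_subset[OF assms(1) that] by simp
  ultimately show ?thesis
    by (simp add: matching_sum_def sum.reindex)
qed

section \<open>Complementation in cells\<close>

text \<open>Group the coverings \<open>M\<close> by the set \<open>S c\<close> of vertices that the
  edges of each block \<open>E c\<close> cover. The sets \<open>S c\<close> partition
  \<open>X\<close>, and for fixed \<open>S\<close> the blocks are chosen independently.\<close>

lemma matching_sum_decompose:
  assumes "finite C" "\<And>c. c \<in> C \<Longrightarrow> finite (E c)" "disjoint_family_on E C"
    and K: "\<And>c e. c \<in> C \<Longrightarrow> e \<in> E c \<Longrightarrow> f e \<subseteq> K c" "\<And>c. c \<in> C \<Longrightarrow> finite (K c)"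
  shows "matching_sum f (\<Union>c\<in>C. E c) X w =
    (\<Sum>S | S \<in> Pi\<^sub>E C (\<lambda>c. Pow (K c)) \<and> covers S C X. \<Prod>c\<in>C. matching_sum f (E c) (S c) w)"
proof -
  define \<F> where "\<F> c Y = {M. M \<subseteq> E c \<and> covers f M Y}" for c Y
  define \<S> where "\<S> = {S. S \<in> Pi\<^sub>E C (\<lambda>c. Pow (K c)) \<and> covers S C X}"
  have fF: "finite (\<F> c Y)" if "c \<in> C" for c Y
    unfolding \<F>_def using that assms(2) by (auto intro: finite_subset[of _ "Pow (E c)"])
  have fS: "finite \<S>"
    unfolding \<S>_def using assms by (auto intro!: finite_subset[OF _ finite_PiE[of C "\<lambda>c. Pow (K c)"]])
  have "(\<Sum>S\<in>\<S>. \<Prod>c\<in>C. matching_sum f (E c) (S c) w)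
      = (\<Sum>S\<in>\<S>. \<Sum>m\<in>Pi\<^sub>E C (\<lambda>c. \<F> c (S c)). \<Prod>c\<in>C. \<Prod>e\<in>m c. w e)"
    using assms fF by (intro sum.cong refl) (simp add: matching_sum_def prod_sum_PiE flip: \<F>_def)
  also have "\<dots> = (\<Sum>(S, m)\<in>Sigma \<S> (\<lambda>S. Pi\<^sub>E C (\<lambda>c. \<F> c (S c))). \<Prod>c\<in>C. \<Prod>e\<in>m c. w e)"
    using assms fF fS by (intro sum.Sigma) (auto intro!: finite_PiE)
  also have "\<dots> = (\<Sum>M | M \<subseteq> (\<Union>c\<in>C. E c) \<and> covers f M X. \<Prod>e\<in>M. w e)"
  \<comment> \<open>A covering corresponds to the pair of its covered sets and its traces on the
    blocks; restricting both functions to \<open>C\<close> makes the pair unique.\<close>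
  proof (rule sum.reindex_bij_witness[where
        i = "\<lambda>M. (\<lambda>c\<in>C. \<Union>e\<in>M \<inter> E c. f e, \<lambda>c\<in>C. M \<inter> E c)" and
        j = "\<lambda>(S, m). \<Union>c\<in>C. m c"])
    fix p assume "p \<in> Sigma \<S> (\<lambda>S. Pi\<^sub>E C (\<lambda>c. \<F> c (S c)))"
    then obtain S m where p: "p = (S, m)" and S: "S \<in> Pi\<^sub>E C (\<lambda>c. Pow (K c))" "covers S C X"
      and m: "m \<in> Pi\<^sub>E C (\<lambda>c. \<F> c (S c))" by (auto simp: \<S>_def)
    let ?M = "\<Union>c\<in>C. m c"
    have mE: "m c \<subseteq> E c" and mS: "covers f (m c) (S c)" if "c \<in> C" for c
      using m that by (auto simp: \<F>_def dest: PiE_mem)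
    have inter: "?M \<inter> E c = m c" if "c \<in> C" for c
      using mE that assms(3) by (fastforce simp: disjoint_family_on_def)
    have "(\<lambda>c\<in>C. ?M \<inter> E c) = m"
      using inter m by (intro ext) (auto simp: PiE_def extensional_def)
    moreover have "(\<lambda>c\<in>C. \<Union>e\<in>?M \<inter> E c. f e) = S"
      using inter mS S by (intro ext) (auto simp: PiE_def extensional_def covers_def)
    ultimately show "(\<lambda>M. (\<lambda>c\<in>C. \<Union>e\<in>M \<inter> E c. f e, \<lambda>c\<in>C. M \<inter> E c))
        ((\<lambda>(S, m). \<Union>c\<in>C. m c) p) = p" by (simp add: p)
    have "covers f ?M X"
      unfolding covers_def
    proof
      show "disjoint_family_on f ?M"
        unfolding disjoint_family_on_def
      proof (intro ballI impI)
        fix e e' assume "e \<in> ?M" "e' \<in> ?M" "e \<noteq> e'"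
        then obtain c c' where c: "c \<in> C" "e \<in> m c" "c' \<in> C" "e' \<in> m c'" by auto
        show "f e \<inter> f e' = {}"
        proof (cases "c = c'")
          case True
          then show ?thesis using mS[of c] c \<open>e \<noteq> e'\<close>
            by (auto simp: covers_def disjoint_family_on_def)
        next
          case False
          then have "S c \<inter> S c' = {}" using S c by (auto simp: covers_def disjoint_family_on_def)
          moreover have "f e \<subseteq> S c" "f e' \<subseteq> S c'" using mS c by (auto simp: covers_def)
          ultimately show ?thesis by blast
        qed
      qed
      show "(\<Union>e\<in>?M. f e) = X"
        using S mS by (auto simp: covers_def)
    qed
    then show "(\<lambda>(S, m). \<Union>c\<in>C. m c) p \<in> {M. M \<subseteq> (\<Union>c\<in>C. E c) \<and> covers f M X}"
      using mE by (auto simp: p)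
    have "(\<Prod>e\<in>?M. w e) = (\<Prod>c\<in>C. \<Prod>e\<in>m c. w e)"
    proof (rule prod.UNION_disjoint)
      show "\<forall>i\<in>C. finite (m i)" using mE assms(2) finite_subset by blast
      show "\<forall>i\<in>C. \<forall>j\<in>C. i \<noteq> j \<longrightarrow> m i \<inter> m j = {}"
        using mE assms(3) by (fastforce simp: disjoint_family_on_def)
    qed (fact assms)
    then show "(\<Prod>e\<in>(\<lambda>(S, m). \<Union>c\<in>C. m c) p. w e) = (case p of (S, m) \<Rightarrow> \<Prod>c\<in>C. \<Prod>e\<in>m c. w e)"
      by (simp add: p)
  next
    fix M assume "M \<in> {M. M \<subseteq> (\<Union>c\<in>C. E c) \<and> covers f M X}"
    then have M: "M \<subseteq> (\<Union>c\<in>C. E c)" "covers f M X" by auto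
    show "(\<lambda>(S, m). \<Union>c\<in>C. m c) ((\<lambda>M. (\<lambda>c\<in>C. \<Union>e\<in>M \<inter> E c. f e, \<lambda>c\<in>C. M \<inter> E c)) M) = M"
      using M by auto
    have "covers f (M \<inter> E c) (\<Union>e\<in>M \<inter> E c. f e)" for c
      using M by (auto simp: covers_def disjoint_family_on_def)
    moreover have "covers (\<lambda>c\<in>C. \<Union>e\<in>M \<inter> E c. f e) C X"
      unfolding covers_def
    proof
      show "disjoint_family_on (\<lambda>c\<in>C. \<Union>e\<in>M \<inter> E c. f e) C"
        unfolding disjoint_family_on_def
      proof (intro ballI impI)
        fix c c' assume c: "c \<in> C" "c' \<in> C" "c \<noteq> c'"
        then have "E c \<inter> E c' = {}" using assms(3) by (auto simp: disjoint_family_on_def)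
        have "f e \<inter> f e' = {}" if "e \<in> M \<inter> E c" "e' \<in> M \<inter> E c'" for e e'
        proof -
          have "e \<noteq> e'" using that \<open>E c \<inter> E c' = {}\<close> by auto
          then show ?thesis using that M by (simp add: covers_def disjoint_family_on_def)
        qed
        then show "(\<lambda>c\<in>C. \<Union>e\<in>M \<inter> E c. f e) c \<inter> (\<lambda>c\<in>C. \<Union>e\<in>M \<inter> E c. f e) c' = {}"
          using c by auto
      qed
      show "(\<Union>c\<in>C. (\<lambda>c\<in>C. \<Union>e\<in>M \<inter> E c. f e) c) = X"
      proof -
        have "(\<Union>c\<in>C. \<Union>e\<in>M \<inter> E c. f e) = (\<Union>e\<in>M. f e)" using M(1) by blast
        then show ?thesis using M(2) by (simp add: covers_def)
      qed
    qed
    moreover have "(\<Union>e\<in>M \<inter> E c. f e) \<subseteq> K c" if "c \<in> C" for c using K that by auto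
    ultimately show "(\<lambda>c\<in>C. \<Union>e\<in>M \<inter> E c. f e, \<lambda>c\<in>C. M \<inter> E c)
        \<in> Sigma \<S> (\<lambda>S. Pi\<^sub>E C (\<lambda>c. \<F> c (S c)))"
      by (auto simp: \<S>_def \<F>_def)
  qed
  finally show ?thesis by (simp add: matching_sum_def \<S>_def)
qed

text \<open>Passing to \<open>K c - S c\<close> in every block is a bijection from the assignments
  covering \<open>X'\<close> to those covering \<open>X\<close>: by \<open>deg\<close> the counts of
  an assignment and of its complement have the right total at each vertex.\<close>

lemma matching_sum_complement:
  fixes w w' :: "'e \<Rightarrow> 'a :: field"
  assumes "finite C" "\<And>c. c \<in> C \<Longrightarrow> finite (E c)" "disjoint_family_on E C"
    and K: "\<And>c e. c \<in> C \<Longrightarrow> e \<in> E c \<Longrightarrow> f e \<subseteq> K c" "\<And>c. c \<in> C \<Longrightarrow> finite (K c)"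
    and deg: "\<And>x. card {c \<in> C. x \<in> K c} = of_bool (x \<in> X) + of_bool (x \<in> X')"
    and cell: "\<And>c S. c \<in> C \<Longrightarrow> S \<subseteq> K c \<Longrightarrow>
      matching_sum f (E c) (K c - S) w = \<Delta> c * matching_sum f (E c) S w'"
  shows "matching_sum f (\<Union>c\<in>C. E c) X w = (\<Prod>c\<in>C. \<Delta> c) * matching_sum f (\<Union>c\<in>C. E c) X' w'"
proof -
  let ?S = "\<lambda>X. {S. S \<in> Pi\<^sub>E C (\<lambda>c. Pow (K c)) \<and> covers S C X}"
  let ?co = "\<lambda>S. \<lambda>c\<in>C. K c - S c"
  have coco: "?co (?co S) = S" if "S \<in> Pi\<^sub>E C (\<lambda>c. Pow (K c))" for S
    using that by (intro ext) (auto simp: PiE_def extensional_def)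
  have cov: "covers (?co S) C X \<longleftrightarrow> covers S C X'" if "S \<in> Pi\<^sub>E C (\<lambda>c. Pow (K c))" for S
  proof -
    have "card {c \<in> C. x \<in> ?co S c} + card {c \<in> C. x \<in> S c} = of_bool (x \<in> X) + of_bool (x \<in> X')" for x
    proof -
      have "{c \<in> C. x \<in> K c} = {c \<in> C. x \<in> ?co S c} \<union> {c \<in> C. x \<in> S c}"
        using that by auto
      moreover have "{c \<in> C. x \<in> ?co S c} \<inter> {c \<in> C. x \<in> S c} = {}" by auto
      ultimately show ?thesis
        using deg[of x] assms(1) by (subst card_Un_disjoint[symmetric]) auto
    qed
    note add = this
    \<comment> \<open>The two counts add up to the two desired values, so one is correct iff the
      other is.\<close>
    have "(card {c \<in> C. x \<in> ?co S c} = of_bool (x \<in> X)) \<longleftrightarrow>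
        (card {c \<in> C. x \<in> S c} = of_bool (x \<in> X'))" for x
      using add[of x] by linarith
    then show ?thesis by (simp only: covers_iff_card[OF assms(1)])
  qed
  have "matching_sum f (\<Union>c\<in>C. E c) X w = (\<Sum>S\<in>?S X. \<Prod>c\<in>C. matching_sum f (E c) (S c) w)"
    by (rule matching_sum_decompose) (use assms in auto)
  also have "\<dots> = (\<Sum>S\<in>?S X'. \<Prod>c\<in>C. matching_sum f (E c) (?co S c) w)"
  proof (rule sum.reindex_bij_witness[where i = ?co and j = ?co])
    fix S assume S: "S \<in> ?S X'"
    then show "?co (?co S) = S" using coco by blast
    show "?co S \<in> ?S X" using S cov[of S] by auto
  next
    fix S assume S: "S \<in> ?S X"
    then show "?co (?co S) = S" using coco by blast
    moreover have "?co S \<in> Pi\<^sub>E C (\<lambda>c. Pow (K c))" by auto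
    ultimately show "?co S \<in> ?S X'" using S cov[of "?co S"] by auto
    show "(\<Prod>c\<in>C. matching_sum f (E c) (?co (?co S) c) w) = (\<Prod>c\<in>C. matching_sum f (E c) (S c) w)"
      by (subst coco) (use S in auto)
  qed
  also have "\<dots> = (\<Sum>S\<in>?S X'. \<Prod>c\<in>C. \<Delta> c * matching_sum f (E c) (S c) w')"
  proof (intro sum.cong prod.cong refl)
    fix S c assume "S \<in> ?S X'" "c \<in> C"
    then have "S c \<subseteq> K c" by auto
    then show "matching_sum f (E c) (?co S c) w = \<Delta> c * matching_sum f (E c) (S c) w'"
      using cell \<open>c \<in> C\<close> by simp
  qed
  also have "\<dots> = (\<Prod>c\<in>C. \<Delta> c) * (\<Sum>S\<in>?S X'. \<Prod>c\<in>C. matching_sum f (E c) (S c) w')"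
    by (simp add: prod.distrib sum_distrib_left)
  also have "(\<Sum>S\<in>?S X'. \<Prod>c\<in>C. matching_sum f (E c) (S c) w') = matching_sum f (\<Union>c\<in>C. E c) X' w'"
    by (rule matching_sum_decompose[symmetric]) (use assms in auto)
  finally show ?thesis .
qed

text \<open>\<open>e1, e4\<close> and \<open>e2, e3\<close> are the opposite pairs. If
  \<open>S\<close> is the pair of ends of an edge, its complement is that of the opposite edge. The
  empty set has sum 1; the full set has sum \<open>\<Delta>\<close> under \<open>w\<close> and
  \<open>1 / \<Delta>\<close> under \<open>w'\<close>. All other subsets have sum 0 on both
  sides.\<close>

lemma four_cycle_complement:
  fixes w w' :: "'e \<Rightarrow> 'a :: field"
  assumes "distinct [p, q, x, y]" "distinct [e1, e2, e3, e4]"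
    and ends: "f e1 = {p, x}" "f e2 = {p, y}" "f e3 = {q, x}" "f e4 = {q, y}"
    and \<Delta>: "\<Delta> = w e1 * w e4 + w e2 * w e3" "\<Delta> \<noteq> 0"
    and w': "w' e1 = w e4 / \<Delta>" "w' e2 = w e3 / \<Delta>" "w' e3 = w e2 / \<Delta>" "w' e4 = w e1 / \<Delta>"
    and S: "S \<subseteq> {p, q, x, y}"
  shows "matching_sum f {e1, e2, e3, e4} ({p, q, x, y} - S) w
    = \<Delta> * matching_sum f {e1, e2, e3, e4} S w'"
proof -
  have d: "e1 \<noteq> e2" "e1 \<noteq> e3" "e1 \<noteq> e4" "e2 \<noteq> e3" "e2 \<noteq> e4" "e3 \<noteq> e4"
    "p \<noteq> q" "p \<noteq> x" "p \<noteq> y" "q \<noteq> x" "q \<noteq> y" "x \<noteq> y" using assms by auto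
  have d': "q \<noteq> p" "x \<noteq> p" "y \<noteq> p" "x \<noteq> q" "y \<noteq> q" "y \<noteq> x" using d by auto
  have \<Delta>': "w e1 * w e4 + w e2 * w e3 = \<Delta>" "w e4 * w e1 + w e3 * w e2 = \<Delta>"
    "w e2 * w e3 + w e1 * w e4 = \<Delta>" "w e3 * w e2 + w e4 * w e1 = \<Delta>"
    using \<Delta>(1) by (simp_all add: ac_simps)
  \<comment> \<open>Unfolding the power set yields the sixteen cases, each evaluated by inserting
    the four edges one at a time.\<close>
  have "S \<in> Pow {p, q, x, y}" using S by simp
  then show ?thesis
    unfolding Pow_insert Pow_empty image_insert image_empty Un_insert_left Un_empty_left
      insert_iff empty_iff
    by (elim disjE) (simp_all add: matching_sum_insert matching_sum_empty ends d d' insert_Diff_if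
      w' \<Delta>(2) \<Delta>' flip: add_divide_distrib)
qed

section \<open>Reduction of the Aztec diamond\<close>

abbreviation aztec_ends :: "nat \<times> nat \<Rightarrow> aztec_vertex set" where
  "aztec_ends \<equiv> \<lambda>(r, s). aztec_edge r s"

definition aztec_sum :: "nat \<Rightarrow> (nat \<times> nat \<Rightarrow> 'a) \<Rightarrow> 'a :: field" where
  "aztec_sum n w =
     matching_sum aztec_ends ({1..2 * n} \<times> {1..2 * n}) (aztec_vertices n) w"

section \<open>The cells and the vertices between them\<close>

definition cell_edges :: "nat \<times> nat \<Rightarrow> (nat \<times> nat) set" where
  "cell_edges = (\<lambda>(i, j). {(2*i-1, 2*j-1), (2*i-1, 2*j), (2*i, 2*j-1), (2*i, 2*j)})"

definition cell_vertices :: "nat \<times> nat \<Rightarrow> aztec_vertex set" where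
  "cell_vertices = (\<lambda>(i, j). {U (i-1) j, U i j, V i (j-1), V i j})"

definition cell_factor :: "(nat \<times> nat \<Rightarrow> 'a :: field) \<Rightarrow> nat \<times> nat \<Rightarrow> 'a" where
  "cell_factor w = (\<lambda>(i, j). w (2*i-1, 2*j-1) * w (2*i, 2*j) + w (2*i-1, 2*j) * w (2*i, 2*j-1))"

text \<open>Exchanges \<open>2*i-1\<close> and \<open>2*i\<close> for positive \<open>i\<close>, so
  \<open>(opp r, opp s)\<close> is the edge opposite to \<open>(r, s)\<close> in its cell.\<close>

definition opp :: "nat \<Rightarrow> nat" where
  "opp r = (if odd r then r + 1 else r - 1)"

definition flip_cells :: "(nat \<times> nat \<Rightarrow> 'a :: field) \<Rightarrow> nat \<times> nat \<Rightarrow> 'a" where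
  "flip_cells w = (\<lambda>(r, s). w (opp r, opp s) / cell_factor w ((r + 1) div 2, (s + 1) div 2))"

text \<open>These are the vertices lying in two cells; every other vertex of the diamond lies in
  one.\<close>

definition aztec_interior :: "nat \<Rightarrow> aztec_vertex set" where
  "aztec_interior n = {U i j | i j. i \<in> {1..<n} \<and> j \<in> {1..n}} \<union> {V i j | i j. i \<in> {1..n} \<and> j \<in> {1..<n}}"

lemma disjoint_cells: "disjoint_family_on cell_edges ({1..n} \<times> {1..n})"
proof -
  have "(i, j) = ((r + 1) div 2, (s + 1) div 2)"
    if "(r, s) \<in> cell_edges (i, j)" "i \<ge> 1" "j \<ge> 1" for i j r s
    using that by (auto simp: cell_edges_def)
  then have "c = ((fst e + 1) div 2, (snd e + 1) div 2)"
    if "e \<in> cell_edges c" "c \<in> {1..n} \<times> {1..n}" for c e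
    using that by (cases c; cases e) auto
  then show ?thesis
    unfolding disjoint_family_on_def by blast
qed

lemma Union_cells: "(\<Union>c\<in>{1..n} \<times> {1..n}. cell_edges c) = {1..2 * n} \<times> {1..2 * n}"
proof (intro equalityI subsetI)
  fix e assume "e \<in> (\<Union>c\<in>{1..n} \<times> {1..n}. cell_edges c)"
  then show "e \<in> {1..2 * n} \<times> {1..2 * n}" by (auto simp: cell_edges_def)
next
  fix e assume "e \<in> {1..2 * n} \<times> {1..2 * n}"
  then obtain r s where e: "e = (r, s)" "1 \<le> r" "r \<le> 2 * n" "1 \<le> s" "s \<le> 2 * n" by auto
  have "r = 2 * ((r + 1) div 2) - 1 \<or> r = 2 * ((r + 1) div 2)" for r :: nat by presburger
  then have "e \<in> cell_edges ((r + 1) div 2, (s + 1) div 2)"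
    unfolding e(1) cell_edges_def by auto
  moreover have "((r + 1) div 2, (s + 1) div 2) \<in> {1..n} \<times> {1..n}" using e by auto
  ultimately show "e \<in> (\<Union>c\<in>{1..n} \<times> {1..n}. cell_edges c)" by blast
qed

text \<open>\<open>U a b\<close> can only lie in the cells \<open>(a, b)\<close> and
  \<open>(a + 1, b)\<close>, and \<open>V a b\<close> only in \<open>(a, b)\<close> and
  \<open>(a, b + 1)\<close>; the bounds decide which of these exist.\<close>

lemma card_cells_at:
  "card {c \<in> {1..n} \<times> {1..n}. x \<in> cell_vertices c} =
    of_bool (x \<in> aztec_vertices n) + of_bool (x \<in> aztec_interior n)"
proof (cases x)
  case (U a b)
  have "{c \<in> {1..n} \<times> {1..n}. x \<in> cell_vertices c} =
    (if b \<in> {1..n} then (if a \<in> {1..n} then {(a, b)} else {}) \<union> (if a < n then {(a + 1, b)} else {})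
     else {})"
    unfolding U cell_vertices_def by auto
  then show ?thesis by (auto simp: U aztec_vertices_def aztec_interior_def)
next
  case (V a b)
  have "{c \<in> {1..n} \<times> {1..n}. x \<in> cell_vertices c} =
    (if a \<in> {1..n} then (if b \<in> {1..n} then {(a, b)} else {}) \<union> (if b < n then {(a, b + 1)} else {})
     else {})"
    unfolding V cell_vertices_def by auto
  then show ?thesis by (auto simp: V aztec_vertices_def aztec_interior_def)
qed

text \<open>The array of edges of order \<open>m\<close> sits centred in that of order
  \<open>m + 1\<close>, shifted by one in both directions. The shift changes parities, so it
  interchanges the two kinds of vertices.\<close>

fun inward :: "aztec_vertex \<Rightarrow> aztec_vertex" where
  "inward (U i j) = V (i + 1) j"
| "inward (V i j) = U i (j + 1)"

lemma inj_inward: "inj inward"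
proof (rule injI)
  fix x y assume "inward x = inward y"
  then show "x = y" by (cases x; cases y) auto
qed

lemma inward_vertices: "inward ` aztec_vertices m = aztec_interior (Suc m)"
proof -
  have "inward x \<in> aztec_interior (Suc m) \<longleftrightarrow> x \<in> aztec_vertices m" for x
    by (cases x) (auto simp: aztec_vertices_def aztec_interior_def)
  moreover have "\<exists>y. x = inward y" if "x \<in> aztec_interior (Suc m)" for x
  proof (cases x)
    case (U i j)
    then have "x = inward (V i (j - 1))" using that by (auto simp: aztec_interior_def)
    then show ?thesis by blast
  next
    case (V i j)
    then have "x = inward (U (i - 1) j)" using that by (auto simp: aztec_interior_def)
    then show ?thesis by blast
  qed
  ultimately show ?thesis by blast
qed

text \<open>The outermost rows contain the vertices \<open>U 0 _\<close> and
  \<open>U (Suc m) _\<close>, the outermost columns \<open>V _ 0\<close> and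
  \<open>V _ (Suc m)\<close>; all other edges avoid the boundary.\<close>

lemma interior_edges:
  "{e \<in> {1..2 * Suc m} \<times> {1..2 * Suc m}. aztec_ends e \<subseteq> aztec_interior (Suc m)} =
    (\<lambda>(r, s). (r + 1, s + 1)) ` ({1..2 * m} \<times> {1..2 * m})"
proof -
  have "aztec_ends (r, s) \<subseteq> aztec_interior (Suc m) \<longleftrightarrow>
      r \<in> {2..2 * m + 1} \<and> s \<in> {2..2 * m + 1}" for r s
    by (auto simp: aztec_edge_def aztec_interior_def)
  then have "{e \<in> {1..2 * Suc m} \<times> {1..2 * Suc m}. aztec_ends e \<subseteq> aztec_interior (Suc m)} =
      {2..2 * m + 1} \<times> {2..2 * m + 1}"
    by (intro set_eqI) (simp only: split_paired_all mem_Collect_eq mem_Times_iff fst_conv snd_conv, auto)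
  also have "\<dots> = (\<lambda>(r, s). (r + 1, s + 1)) ` ({1..2 * m} \<times> {1..2 * m})"
  proof (intro equalityI subsetI)
    fix e assume "e \<in> {2..2 * m + 1} \<times> {2..2 * m + 1}"
    then show "e \<in> (\<lambda>(r, s). (r + 1, s + 1)) ` ({1..2 * m} \<times> {1..2 * m})"
      by (intro image_eqI[of _ _ "(fst e - 1, snd e - 1)"]) auto
  qed auto
  finally show ?thesis .
qed

lemma cell_complement:
  fixes w :: "nat \<times> nat \<Rightarrow> 'a :: field"
  assumes "1 \<le> fst c" "1 \<le> snd c" "cell_factor w c \<noteq> 0" "S \<subseteq> cell_vertices c"
  shows "matching_sum aztec_ends (cell_edges c) (cell_vertices c - S) w =
    cell_factor w c * matching_sum aztec_ends (cell_edges c) S (flip_cells w)"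
proof -
  obtain i j where c: "c = (i, j)" "1 \<le> i" "1 \<le> j" using assms by (cases c) auto
  have h: "(2 * i - 1 + 1) div 2 = i" "(2 * j - 1 + 1) div 2 = j"
    "(2 * i + 1) div 2 = i" "(2 * j + 1) div 2 = j"
    "odd (2 * i - 1)" "odd (2 * j - 1)" "2 * i - 1 + 1 = 2 * i" "2 * j - 1 + 1 = 2 * j"
    using c by auto
  show ?thesis
    unfolding c(1) cell_edges_def cell_vertices_def prod.case
  proof (rule four_cycle_complement)
    show "distinct [U (i - 1) j, U i j, V i (j - 1), V i j]" using c by auto
    show "distinct [(2 * i - 1, 2 * j - 1), (2 * i - 1, 2 * j), (2 * i, 2 * j - 1), (2 * i, 2 * j)]"
      using c by auto
    show "S \<subseteq> {U (i - 1) j, U i j, V i (j - 1), V i j}"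
      using assms by (simp add: c cell_vertices_def)
    show "cell_factor w (i, j) \<noteq> 0" using assms c by simp
    show "cell_factor w (i, j) =
      w (2 * i - 1, 2 * j - 1) * w (2 * i, 2 * j) + w (2 * i - 1, 2 * j) * w (2 * i, 2 * j - 1)"
      by (simp add: cell_factor_def)
  qed (use aztec_edge_cases[OF c(2,3)] in \<open>simp_all add: flip_cells_def opp_def h del: One_nat_def\<close>)
qed

text \<open>Complementing all cells leaves the interior to be covered, and the edges inside it form
  the diamond of order \<open>m\<close> through \<open>inward\<close>.\<close>

lemma aztec_reduction:
  fixes w :: "nat \<times> nat \<Rightarrow> 'a :: field"
  assumes "\<And>i j. i \<in> {1..Suc m} \<Longrightarrow> j \<in> {1..Suc m} \<Longrightarrow> cell_factor w (i, j) \<noteq> 0"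
  shows "aztec_sum (Suc m) w = (\<Prod>c\<in>{1..Suc m} \<times> {1..Suc m}. cell_factor w c) *
    aztec_sum m (\<lambda>(r, s). flip_cells w (r + 1, s + 1))"
proof -
  let ?C = "{1..Suc m} \<times> {1..Suc m}" and ?E = "{1..2 * Suc m} \<times> {1..2 * Suc m}"
  have "aztec_sum (Suc m) w = (\<Prod>c\<in>?C. cell_factor w c) *
      matching_sum aztec_ends ?E (aztec_interior (Suc m)) (flip_cells w)"
    unfolding aztec_sum_def Union_cells[symmetric]
  proof (rule matching_sum_complement)
    show "aztec_ends e \<subseteq> cell_vertices c" if "c \<in> ?C" "e \<in> cell_edges c" for c e
      using that by (auto simp: cell_edges_def cell_vertices_def aztec_edge_def)
    show "matching_sum aztec_ends (cell_edges c) (cell_vertices c - S) w =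
        cell_factor w c * matching_sum aztec_ends (cell_edges c) S (flip_cells w)"
      if "c \<in> ?C" "S \<subseteq> cell_vertices c" for c S
      using that assms[of "fst c" "snd c"] by (intro cell_complement) auto
    show "card {c \<in> ?C. x \<in> cell_vertices c} =
        of_bool (x \<in> aztec_vertices (Suc m)) + of_bool (x \<in> aztec_interior (Suc m))" for x
      by (rule card_cells_at)
  qed (simp_all only: disjoint_cells, auto simp: cell_edges_def cell_vertices_def)
  also have "matching_sum aztec_ends ?E (aztec_interior (Suc m)) (flip_cells w) =
      matching_sum aztec_ends ((\<lambda>(r, s). (r + 1, s + 1)) ` ({1..2 * m} \<times> {1..2 * m}))
        (inward ` aztec_vertices m) (flip_cells w)"
    by (subst matching_sum_restrict) (simp only: interior_edges inward_vertices)
  also have "\<dots> = matching_sum aztec_ends ({1..2 * m} \<times> {1..2 * m}) (aztec_vertices m)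
      (\<lambda>e. flip_cells w ((\<lambda>(r, s). (r + 1, s + 1)) e))"
    by (rule matching_sum_reindex) (auto intro!: inj_onI inj_inward simp: aztec_edge_def)
  finally show ?thesis by (simp add: aztec_sum_def case_prod_unfold)
qed

section \<open>Weights constant along antidiagonals of cells\<close>

text \<open>For the cells with \<open>i + j = t\<close>, \<open>a t\<close> and \<open>d t\<close>
  sit on one pair of opposite edges and 1 on the other pair, so the cell factor is
  \<open>1 + a t * d t\<close>.\<close>

definition diag_weight :: "(nat \<Rightarrow> 'a) \<Rightarrow> (nat \<Rightarrow> 'a) \<Rightarrow> nat \<times> nat \<Rightarrow> 'a :: field" where
  "diag_weight a d = (\<lambda>(r, s).
     if odd r \<and> odd s then a ((r + 1) div 2 + (s + 1) div 2)
     else if even r \<and> even s then d (r div 2 + s div 2)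
     else 1)"

fun vertex_level :: "aztec_vertex \<Rightarrow> nat" where
  "vertex_level (U i j) = i + j"
| "vertex_level (V i j) = i + j"

text \<open>Remove the column \<open>j = 1\<close> from the factors \<open>h (i + j)\<close> and the
  row \<open>i = Suc m\<close> from the factors \<open>h (i + j + 1)\<close>. What remains is
  indexed by the \<open>U\<close> and \<open>V\<close> vertices of order \<open>m\<close>; the
  removed factors run once through the levels 2 to \<open>2 * Suc m + 1\<close>.\<close>

lemma prod_square_levels:
  fixes h :: "nat \<Rightarrow> 'a :: field"
  shows "(\<Prod>(i, j)\<in>{1..Suc m} \<times> {1..Suc m}. h (i + j) * h (i + j + 1)) =
    (\<Prod>i=1..Suc m. h (2 * i) * h (2 * i + 1)) * (\<Prod>x\<in>aztec_vertices m. h (vertex_level x + 2))"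
proof -
  let ?N = "{1..Suc m}"
  have U: "(\<Prod>(i, j)\<in>?N \<times> {2..Suc m}. h (i + j)) = (\<Prod>x\<in>{U i j | i j. 0 \<le> i \<and> i \<le> m \<and> 1 \<le> j \<and> j \<le> m}. h (vertex_level x + 2))"
    by (rule prod.reindex_bij_witness[where
      i = "\<lambda>x. case x of U i j \<Rightarrow> (i + 1, j + 1) | V i j \<Rightarrow> undefined" and j = "\<lambda>(i, j). U (i - 1) (j - 1)"])
      (auto simp: numeral_2_eq_2 intro!: arg_cong[of _ _ h])
  have V: "(\<Prod>(i, j)\<in>{1..m} \<times> ?N. h (i + j + 1)) = (\<Prod>x\<in>{V i j | i j. 1 \<le> i \<and> i \<le> m \<and> 0 \<le> j \<and> j \<le> m}. h (vertex_level x + 2))"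
    by (rule prod.reindex_bij_witness[where
      i = "\<lambda>x. case x of V i j \<Rightarrow> (i, j + 1) | U i j \<Rightarrow> undefined" and j = "\<lambda>(i, j). V i (j - 1)"]) auto
  have fin: "finite {U i j | i j. 0 \<le> i \<and> i \<le> m \<and> 1 \<le> j \<and> j \<le> m}"
    "finite {V i j | i j. 1 \<le> i \<and> i \<le> m \<and> 0 \<le> j \<and> j \<le> m}"
    by (rule finite_subset[of _ "case_prod U ` ({0..m} \<times> {0..m})"], force, simp)
       (rule finite_subset[of _ "case_prod V ` ({0..m} \<times> {0..m})"], force, simp)
  have vertices: "(\<Prod>x\<in>aztec_vertices m. h (vertex_level x + 2)) =
      (\<Prod>(i, j)\<in>?N \<times> {2..Suc m}. h (i + j)) * (\<Prod>(i, j)\<in>{1..m} \<times> ?N. h (i + j + 1))"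
    unfolding aztec_vertices_def U V by (rule prod.union_disjoint) (use fin in auto)
  have low: "(\<Prod>(i, j)\<in>?N \<times> ?N. h (i + j)) =
      (\<Prod>i=1..Suc m. h (i + 1)) * (\<Prod>(i, j)\<in>?N \<times> {2..Suc m}. h (i + j))"
  proof -
    have "?N = insert 1 {2..Suc m}" by auto
    then have "(\<Prod>j\<in>?N. h (i + j)) = h (i + 1) * (\<Prod>j\<in>{2..Suc m}. h (i + j))" for i
      by simp
    then show ?thesis by (simp add: prod.distrib flip: prod.cartesian_product)
  qed
  have high: "(\<Prod>(i, j)\<in>?N \<times> ?N. h (i + j + 1)) =
      (\<Prod>(i, j)\<in>{1..m} \<times> ?N. h (i + j + 1)) * (\<Prod>j=1..Suc m. h (Suc m + j + 1))"
    by (simp flip: prod.cartesian_product)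
  have diagonal: "(\<Prod>i=1..k. h (i + 1)) * (\<Prod>j=1..k. h (k + j + 1)) = (\<Prod>i=1..k. h (2 * i) * h (2 * i + 1))" for k
  proof -
    have "(\<Prod>j=1..k. h (k + j + 1)) = (\<Prod>j=k+1..k+k. h (j + 1))"
      by (rule prod.reindex_bij_witness[where i = "\<lambda>j. j - k" and j = "\<lambda>j. j + k"]) (auto simp: ac_simps)
    then have "(\<Prod>i=1..k. h (i + 1)) * (\<Prod>j=1..k. h (k + j + 1)) = (\<Prod>i=1..k+k. h (i + 1))"
      using prod.ub_add_nat[of 1 k "\<lambda>i. h (i + 1)" k] by simp
    also have "\<dots> = (\<Prod>i=1..k. h (2 * i) * h (2 * i + 1))"
      by (induction k) (simp_all add: mult_ac flip: mult_2)
    finally show ?thesis .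
  qed
  have "(\<Prod>(i, j)\<in>?N \<times> ?N. h (i + j) * h (i + j + 1)) =
      (\<Prod>(i, j)\<in>?N \<times> ?N. h (i + j)) * (\<Prod>(i, j)\<in>?N \<times> ?N. h (i + j + 1))"
    by (simp add: case_prod_unfold prod.distrib)
  then show ?thesis
    unfolding low high vertices diagonal[symmetric] by (simp only: mult_ac)
qed

text \<open>
  Here \<open>h (t + 2)\<close> is the gauge at the vertices of level \<open>t\<close>; the condition that it factors the cell
  factors is what restores weight 1 on the antidiagonal edges.
\<close>

lemma aztec_diag_step:
  fixes a d h :: "nat \<Rightarrow> 'a :: field"
  assumes h: "\<And>t. 1 + a t * d t = h t * h (t + 1)" "\<And>t. h t \<noteq> 0"
    and a': "\<And>t. a' t = a t * h (t + 1) / h t"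
    and d': "\<And>t. d' t = d (t + 2) * h (t + 2) / h (t + 3)"
  shows "aztec_sum (Suc m) (diag_weight a d) =
    (\<Prod>i=1..Suc m. 1 + a (2 * i) * d (2 * i)) * aztec_sum m (diag_weight a' d')"
proof -
  let ?w = "diag_weight a d" and ?C = "{1..Suc m} \<times> {1..Suc m}"
  let ?g = "\<lambda>x. h (vertex_level x + 2)"
  have \<Delta>: "cell_factor ?w (i, j) = h (i + j) * h (i + j + 1)" if "1 \<le> i" "1 \<le> j" for i j
    using that h(1)[of "i + j"] by (auto simp: cell_factor_def diag_weight_def add.commute)
  have red: "aztec_sum (Suc m) ?w = (\<Prod>c\<in>?C. cell_factor ?w c) *
      aztec_sum m (\<lambda>(r, s). flip_cells ?w (r + 1, s + 1))"
    by (rule aztec_reduction) (use \<Delta> h(2) in auto)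
  \<comment> \<open>An odd-odd edge of cell \<open>(i, j)\<close> shifts to the even-even edge of
    the same cell, with opposite weight \<open>a (i + j)\<close>. An even-even edge shifts into the
    cell \<open>(i + 1, j + 1)\<close>, whence the offset 2 in \<open>d'\<close>. On mixed edges the
    gauge cancels the cell factor.\<close>
  have w: "diag_weight a' d' e = (\<lambda>(r, s). flip_cells ?w (r + 1, s + 1)) e * (\<Prod>x\<in>aztec_ends e. ?g x)"
    if mem: "e \<in> {1..2 * m} \<times> {1..2 * m}" for e
  proof -
    obtain r s where e: "e = (r, s)" "r \<ge> 1" "s \<ge> 1" using mem by (cases e) auto
    obtain p q where p: "r = 2 * p + 1 \<or> r = 2 * p + 2" and q: "s = 2 * q + 1 \<or> s = 2 * q + 2"
    proof
      show "r = 2 * ((r - 1) div 2) + 1 \<or> r = 2 * ((r - 1) div 2) + 2"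
        "s = 2 * ((s - 1) div 2) + 1 \<or> s = 2 * ((s - 1) div 2) + 2"
        using e(2,3) by presburger+
    qed
    have \<Delta>': "cell_factor ?w (Suc i, Suc j) = h (i + j + 2) * h (i + j + 3)" for i j
      using \<Delta>[of "Suc i" "Suc j"] by (simp add: eval_nat_numeral)
    have w: "?w (r, s) = (if odd r \<and> odd s then a ((r + 1) div 2 + (s + 1) div 2)
        else if even r \<and> even s then d (r div 2 + s div 2) else 1)"
      and w': "diag_weight a' d' (r, s) = (if odd r \<and> odd s then a' ((r + 1) div 2 + (s + 1) div 2)
        else if even r \<and> even s then d' (r div 2 + s div 2) else 1)" for r s
      by (simp_all add: diag_weight_def)
    show ?thesis
      using p q unfolding e(1)
      by (elim disjE; simp add: flip_cells_def opp_def aztec_edge_def a' d' \<Delta>'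
          w w' h(2) field_simps; (simp add: eval_nat_numeral)?)
  qed
  have "aztec_sum m (diag_weight a' d') =
      (\<Prod>x\<in>aztec_vertices m. ?g x) * aztec_sum m (\<lambda>(r, s). flip_cells ?w (r + 1, s + 1))"
    unfolding aztec_sum_def
    by (subst matching_sum_cong[OF w], assumption, subst matching_sum_gauge)
       (auto simp: aztec_edge_def)
  moreover have "(\<Prod>c\<in>?C. cell_factor ?w c) =
      (\<Prod>i=1..Suc m. h (2 * i) * h (2 * i + 1)) * (\<Prod>x\<in>aztec_vertices m. ?g x)"
  proof -
    have "(\<Prod>c\<in>?C. cell_factor ?w c) = (\<Prod>(i, j)\<in>?C. h (i + j) * h (i + j + 1))"
      using \<Delta> by (intro prod.cong) auto
    then show ?thesis by (simp only: prod_square_levels)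
  qed
  \<comment> \<open>The gauge product over the vertices cancels; the remaining
    \<open>h (2 * i) * h (2 * i + 1)\<close> is \<open>1 + a (2 * i) * d (2 * i)\<close>.\<close>
  ultimately show ?thesis
    using red by (simp add: h(1) mult_ac)
qed

section \<open>The five-step sweep\<close>

text \<open>With sequences given by one period as a list, a reduction step becomes a computation on
  finitely many entries.\<close>

definition periodic :: "'a list \<Rightarrow> nat \<Rightarrow> 'a" where
  "periodic xs t = xs ! (t mod length xs)"

lemma periodic_rotate: "xs \<noteq> [] \<Longrightarrow> periodic (rotate k xs) t = periodic xs (t + k)"
  by (simp add: periodic_def nth_rotate mod_add_left_eq mod_add_right_eq add.commute)

lemma periodic_rotate1: "xs \<noteq> [] \<Longrightarrow> periodic (rotate1 xs) t = periodic xs (t + 1)"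
  using periodic_rotate[of xs 1 t] by simp

lemma periodic_map2:
  assumes "length xs = length ys" "ys \<noteq> []"
  shows "periodic (map2 f xs ys) t = f (periodic xs t) (periodic ys t)"
proof -
  have "t mod length ys < length ys" using assms by simp
  then show ?thesis using assms by (simp add: periodic_def)
qed

text \<open>The index \<open>2 * i\<close> meets \<open>x\<close> when \<open>i\<close> is 0 modulo
  5 and \<open>y\<close> when it is 1; the exponents count such \<open>i\<close> up to
  \<open>m\<close>.\<close>

lemma prod_periodic_even:
  fixes x y :: "'a :: field"
  shows "(\<Prod>i=1..m. periodic [x, x', y, y', 1, 1, 1, 1, 1, 1] (2 * i)) =
    x ^ (m div 5) * y ^ ((m + 4) div 5)"
proof (induction m)
  case (Suc m)
  let ?r = "Suc m mod 5"
  have "periodic [x, x', y, y', 1, 1, 1, 1, 1, 1] (2 * Suc m) = [x, x', y, y', 1, 1, 1, 1, 1, 1] ! (2 * ?r)"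
    using mult_mod_right[of 2 "Suc m" 5] by (simp add: periodic_def)
  moreover have "?r = 0 \<or> ?r = 1 \<or> ?r = 2 \<or> ?r = 3 \<or> ?r = 4" by presburger
  ultimately have new: "periodic [x, x', y, y', 1, 1, 1, 1, 1, 1] (2 * Suc m) =
      (if ?r = 0 then x else if ?r = 1 then y else 1)"
    by (elim disjE) simp_all
  have "x ^ (Suc m div 5) = x ^ (m div 5) * (if ?r = 0 then x else 1)"
    by (simp add: div_Suc)
  moreover have "(Suc m + 4) div 5 = (if ?r = 1 then Suc ((m + 4) div 5) else (m + 4) div 5)"
    by presburger
  ultimately show ?case
    using Suc.IH by (simp add: new del: mult_Suc_right)
qed simp

text \<open>In every step of the sweep the cell factors differing from 1 lie at the residues 0 to 3,
  which fixes the shape of the list in both \<open>\<Delta>\<close> assumptions;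
  \<open>rotate1 hs\<close> stands for \<open>h (t + 1)\<close>.\<close>

lemma aztec_periodic_step:
  fixes as ds hs as' ds' :: "'a :: field list"
  assumes len: "length as = length hs" "length ds = length hs" and hs: "hs \<noteq> []" "0 \<notin> set hs"
    and \<Delta>: "map2 (\<lambda>x y. 1 + x * y) as ds = [x, x', y, y', 1, 1, 1, 1, 1, 1]"
      "map2 (*) hs (rotate1 hs) = [x, x', y, y', 1, 1, 1, 1, 1, 1]"
    and a': "as' = map2 (*) as (map2 (/) (rotate1 hs) hs)"
    and d': "ds' = rotate 2 (map2 (*) ds (map2 (/) hs (rotate1 hs)))"
  shows "aztec_sum (Suc m) (diag_weight (periodic as) (periodic ds)) =
    x ^ (Suc m div 5) * y ^ ((m + 5) div 5) *
      aztec_sum m (diag_weight (periodic as') (periodic ds'))"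
proof -
  have ne: "as \<noteq> []" "ds \<noteq> []" "rotate1 hs \<noteq> []"
    "map2 (/) (rotate1 hs) hs \<noteq> []" "map2 (/) hs (rotate1 hs) \<noteq> []"
    "map2 (*) ds (map2 (/) hs (rotate1 hs)) \<noteq> []"
    using len hs by (auto simp: zip_eq_Nil_iff)
  note per = periodic_map2 periodic_rotate periodic_rotate1 ne len hs(1)
  have prods: "1 + periodic as t * periodic ds t = periodic [x, x', y, y', 1, 1, 1, 1, 1, 1] t"
    "periodic hs t * periodic hs (t + 1) = periodic [x, x', y, y', 1, 1, 1, 1, 1, 1] t" for t
    using arg_cong[OF \<Delta>(1), of "\<lambda>xs. periodic xs t"] arg_cong[OF \<Delta>(2), of "\<lambda>xs. periodic xs t"]
    by (simp_all add: per)
  have "aztec_sum (Suc m) (diag_weight (periodic as) (periodic ds)) =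
      (\<Prod>i=1..Suc m. 1 + periodic as (2 * i) * periodic ds (2 * i)) *
      aztec_sum m (diag_weight (periodic as') (periodic ds'))"
  proof (rule aztec_diag_step[where h = "periodic hs"])
    fix t
    show "1 + periodic as t * periodic ds t = periodic hs t * periodic hs (t + 1)"
      by (simp only: prods)
    have "periodic hs t \<in> set hs" unfolding periodic_def using hs(1) by (intro nth_mem) simp
    then show "periodic hs t \<noteq> 0" using hs(2) by metis
    show "periodic as' t = periodic as t * periodic hs (t + 1) / periodic hs t"
      by (simp only: a' per length_map length_zip length_rotate1 min.idem times_divide_eq_right not_False_eq_True)
    show "periodic ds' t = periodic ds (t + 2) * periodic hs (t + 2) / periodic hs (t + 3)"
      by (simp only: d' per length_map length_zip length_rotate1 min.idem times_divide_eq_right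
          not_False_eq_True add.assoc numeral_plus_one semiring_norm)
  qed
  also have "(\<Prod>i=1..Suc m. 1 + periodic as (2 * i) * periodic ds (2 * i)) =
      x ^ (Suc m div 5) * y ^ ((m + 5) div 5)"
    unfolding prods prod_periodic_even by simp
  finally show ?thesis .
qed

text \<open>The starting position of a sweep: the supports of the two sequences are disjoint. With
  all parameters 1 it is the indicator of the edges of \<open>B_graph n\<close>.\<close>

definition band_weight :: "'a \<Rightarrow> 'a \<Rightarrow> 'a \<Rightarrow> 'a \<Rightarrow> nat \<times> nat \<Rightarrow> 'a :: field" where
  "band_weight p q r s =
     diag_weight (periodic [p, q, r, s, 0, 0, 0, 0, 0, 0]) (periodic [0, 0, 0, 0, s, r, q, p, 0, 0])"

text \<open>
  The cell factors other than 1 are \<open>x, x\<close> in the second step, \<open>u, v, v, u\<close> in the third and \<open>y, y\<close>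
  in the fourth; \<open>c\<close> is a free alternating gauge.
\<close>

lemma aztec_sweep:
  fixes p q r s x u v y p1 q1 r1 s1 r2 s2 p3 q3 c :: "'a :: field"
  assumes x: "1 + r * s = x" "x \<noteq> 0" and r1: "r1 = r * x" and s1: "s1 = s / x"
    and u: "1 + p * s1 = u" "u \<noteq> 0" and v: "1 + q * r1 = v" "v \<noteq> 0"
    and p1: "p1 = p * u" and q1: "q1 = q * v / u^2" and r2: "r2 = r1 * u^2 / v" and s2: "s2 = s1 / u"
    and y: "1 + p1 * q1 = y" "y \<noteq> 0"
    and c: "c \<noteq> 0"
  shows "aztec_sum (m + 5) (band_weight p q r s) =
    x ^ ((m + 8) div 5) * u ^ ((m + 3) div 5) * v ^ ((m + 7) div 5) * y ^ ((m + 2) div 5) *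
      aztec_sum m (band_weight (p1 * y / c^2) (q1 / y * c^2) (r2 / c^2) (s2 * c^2))"
proof -
  let ?W = "\<lambda>as ds. diag_weight (periodic as) (periodic ds)"
  have nz: "x \<noteq> 0" "u \<noteq> 0" "v \<noteq> 0" "y \<noteq> 0" "c \<noteq> 0" by fact+
  have \<Delta>: "1 + r * s = x" "1 + s * r = x" "1 + p * s1 = u" "1 + s1 * p = u" "1 + q * r1 = v"
    "1 + r1 * q = v" "1 + p1 * q1 = y" "1 + q1 * p1 = y"
    using x u v y by (simp_all add: mult.commute)
  have "aztec_sum (Suc (m + 4)) (?W [p, q, r, s, 0, 0, 0, 0, 0, 0] [0, 0, 0, 0, s, r, q, p, 0, 0]) =
      1 ^ (Suc (m + 4) div 5) * 1 ^ ((m + 4 + 5) div 5) *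
      aztec_sum (m + 4) (?W [p, q, r, s, 0, 0, 0, 0, 0, 0] [0, 0, s, r, q, p, 0, 0, 0, 0])"
    \<comment> \<open>The supports do not meet yet, so the step only moves \<open>d\<close>.\<close>
    by (rule aztec_periodic_step[where hs = "[1,1,1,1,1,1,1,1,1,1]" and x' = 1 and y' = 1])
       (simp_all add: numeral_2_eq_2)
  also have "aztec_sum (m + 4) (?W [p, q, r, s, 0, 0, 0, 0, 0, 0] [0, 0, s, r, q, p, 0, 0, 0, 0]) =
      aztec_sum (Suc (m + 3)) (?W [p, q, r, s, 0, 0, 0, 0, 0, 0] [0, 0, s, r, q, p, 0, 0, 0, 0])"
    by (simp add: eval_nat_numeral)
  also have "\<dots> = 1 ^ (Suc (m + 3) div 5) * x ^ ((m + 3 + 5) div 5) *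
      aztec_sum (m + 3) (?W [p, q, r1, s1, 0, 0, 0, 0, 0, 0] [s1, r1, q, p, 0, 0, 0, 0, 0, 0])"
    by (rule aztec_periodic_step[where hs = "[1,1,1,x,1,1,1,1,1,1]" and x' = 1 and y' = x])
       (use nz in \<open>simp_all add: numeral_2_eq_2 \<Delta> r1 s1\<close>)
  also have "aztec_sum (m + 3) (?W [p, q, r1, s1, 0, 0, 0, 0, 0, 0] [s1, r1, q, p, 0, 0, 0, 0, 0, 0]) =
      aztec_sum (Suc (m + 2)) (?W [p, q, r1, s1, 0, 0, 0, 0, 0, 0] [s1, r1, q, p, 0, 0, 0, 0, 0, 0])"
    by (simp add: eval_nat_numeral)
  also have "\<dots> = u ^ (Suc (m + 2) div 5) * v ^ ((m + 2 + 5) div 5) *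
      aztec_sum (m + 2) (?W [p1, q1, r2, s2, 0, 0, 0, 0, 0, 0] [q1, p1, 0, 0, 0, 0, 0, 0, s2, r2])"
    \<comment> \<open>The gauge is solved from its first entry 1 by dividing the successive factors
      \<open>u, v, v, u\<close>; it returns to 1 because this list is a palindrome.\<close>
    by (rule aztec_periodic_step[where hs = "[1,u,v/u,u,1,1,1,1,1,1]" and x' = v and y' = u])
       (use nz in \<open>simp_all add: numeral_2_eq_2 \<Delta> p1 q1 r2 s2\<close>)
  also have "aztec_sum (m + 2) (?W [p1, q1, r2, s2, 0, 0, 0, 0, 0, 0] [q1, p1, 0, 0, 0, 0, 0, 0, s2, r2]) =
      aztec_sum (Suc (m + 1)) (?W [p1, q1, r2, s2, 0, 0, 0, 0, 0, 0] [q1, p1, 0, 0, 0, 0, 0, 0, s2, r2])"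
    by simp
  also have "\<dots> = y ^ (Suc (m + 1) div 5) * 1 ^ ((m + 1 + 5) div 5) *
      aztec_sum (m + 1) (?W [p1*y, q1/y, r2, s2, 0, 0, 0, 0, 0, 0] [0, 0, 0, 0, 0, 0, s2, r2, q1/y, p1*y])"
    by (rule aztec_periodic_step[where hs = "[1,y,1,1,1,1,1,1,1,1]" and x' = y and y' = 1])
       (use nz in \<open>simp_all add: numeral_2_eq_2 \<Delta>\<close>)
  also have "aztec_sum (m + 1) (?W [p1*y, q1/y, r2, s2, 0, 0, 0, 0, 0, 0] [0, 0, 0, 0, 0, 0, s2, r2, q1/y, p1*y]) =
      aztec_sum (Suc m) (?W [p1*y, q1/y, r2, s2, 0, 0, 0, 0, 0, 0] [0, 0, 0, 0, 0, 0, s2, r2, q1/y, p1*y])"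
    by simp
  also have "\<dots> = 1 ^ (Suc m div 5) * 1 ^ ((m + 5) div 5) *
      aztec_sum m (?W [p1*y/c^2, q1/y*c^2, r2/c^2, s2*c^2, 0, 0, 0, 0, 0, 0]
        [0, 0, 0, 0, s2*c^2, r2/c^2, q1/y*c^2, p1*y/c^2, 0, 0])"
    \<comment> \<open>All factors are 1, so neighbouring gauge values need only be inverse to each
      other.\<close>
    by (rule aztec_periodic_step[where hs = "[c,1/c,c,1/c,c,1/c,c,1/c,c,1/c]" and x' = 1 and y' = 1])
       (use nz in \<open>simp_all add: numeral_2_eq_2\<close>)
  finally have "aztec_sum (Suc (m + 4)) (?W [p, q, r, s, 0, 0, 0, 0, 0, 0] [0, 0, 0, 0, s, r, q, p, 0, 0]) =
      1 ^ (Suc (m + 4) div 5) * 1 ^ ((m + 4 + 5) div 5) * (1 ^ (Suc (m + 3) div 5) * x ^ ((m + 3 + 5) div 5) *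
      (u ^ (Suc (m + 2) div 5) * v ^ ((m + 2 + 5) div 5) * (y ^ (Suc (m + 1) div 5) * 1 ^ ((m + 1 + 5) div 5) *
      (1 ^ (Suc m div 5) * 1 ^ ((m + 5) div 5) *
      aztec_sum m (?W [p1*y/c^2, q1/y*c^2, r2/c^2, s2*c^2, 0, 0, 0, 0, 0, 0]
        [0, 0, 0, 0, s2*c^2, r2/c^2, q1/y*c^2, p1*y/c^2, 0, 0])))))" .
  moreover have "Suc (m + 4) = m + 5" "Suc (m + 2) = m + 3" "Suc (m + 1) = m + 2"
    "m + 2 + 5 = m + 7" "m + 3 + 5 = m + 8" by simp_all
  ultimately show ?thesis
    by (simp only: band_weight_def power_one mult_1_left mult_1_right mult.assoc)
qed

section \<open>Six sweeps and their total factor\<close>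

definition sweep_exponent :: "nat \<Rightarrow> nat" where
  "sweep_exponent m = (m + 8) div 5 + (m + 3) div 5 + (m + 7) div 5 + (m + 2) div 5"

text \<open>
  The values of \<open>c\<close> keep the fractions small; their product \<open>81\<close> is forced by the return to ones.
\<close>

lemma band_return:
  "aztec_sum (m + 30) (band_weight 1 1 1 1 :: _ \<Rightarrow> rat) =
    81 ^ (sweep_exponent m + 10) * aztec_sum m (band_weight 1 1 1 1)"
proof -
  let ?e1 = "(m + 8) div 5" and ?e2 = "(m + 3) div 5" and ?e3 = "(m + 7) div 5" and ?e4 = "(m + 2) div 5"
  \<comment> \<open>A sweep ending at order \<open>m + 5 * k\<close> has every exponent larger by
    \<open>k\<close> than one ending at \<open>m\<close>.\<close>
  have div: "(m + 5 * k + 8) div 5 = ?e1 + k" "(m + 5 * k + 3) div 5 = ?e2 + k"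
    "(m + 5 * k + 7) div 5 = ?e3 + k" "(m + 5 * k + 2) div 5 = ?e4 + k" for k
    by presburger+
  have sweep: "aztec_sum (m + 5 * Suc k) (band_weight p q r s :: _ \<Rightarrow> rat) =
      x ^ (?e1 + k) * u ^ (?e2 + k) * v ^ (?e3 + k) * y ^ (?e4 + k) *
      aztec_sum (m + 5 * k) (band_weight p' q' r' s')"
    if "x = 1 + r * s" "u = 1 + p * s / x" "v = 1 + q * r * x" "y = 1 + p * q * v / u"
      "p' = p * u * y / c^2" "q' = q * v / u^2 / y * c^2" "r' = r * x * u^2 / v / c^2" "s' = s / x / u * c^2"
      "x \<noteq> 0" "u \<noteq> 0" "v \<noteq> 0" "y \<noteq> 0" "c \<noteq> 0"
    for k p q r s x u v y c p' q' r' s'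
  proof -
    have "1 + p * u * (q * v / u^2) = y"
      using that by (simp add: power2_eq_square)
    then have "aztec_sum (m + 5 * k + 5) (band_weight p q r s) =
      x ^ ((m + 5 * k + 8) div 5) * u ^ ((m + 5 * k + 3) div 5) * v ^ ((m + 5 * k + 7) div 5) *
        y ^ ((m + 5 * k + 2) div 5) *
        aztec_sum (m + 5 * k) (band_weight (p * u * y / c^2) (q * v / u^2 / y * c^2)
          (r * x * u^2 / v / c^2) (s / x / u * c^2))"
      by (intro aztec_sweep[OF _ _ refl refl _ _ _ _ refl refl refl refl])
        (use that in \<open>simp_all add: mult.assoc\<close>)
    then show ?thesis unfolding div that(5-8) by (simp add: ac_simps)
  qed
  \<comment> \<open>The six states come from iterating the map from \<open>(1, 1, 1, 1)\<close>.
    After the palindrome \<open>(2, 1/2, 1/2, 2)\<close> they are the earlier ones reversed.\<close>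
  have "aztec_sum (m + 5 * Suc 5) (band_weight 1 1 1 1 :: _ \<Rightarrow> rat) =
      2 ^ (?e1 + 5) * (3/2) ^ (?e2 + 5) * 3 ^ (?e3 + 5) * 3 ^ (?e4 + 5) *
      aztec_sum (m + 5 * 5) (band_weight (1/2) 4 (1/6) 3)"
    by (rule sweep[where c = 3]) (simp_all add: power2_eq_square)
  also have "aztec_sum (m + 5 * 5) (band_weight (1/2) 4 (1/6) 3 :: _ \<Rightarrow> rat) =
      aztec_sum (m + 5 * Suc 4) (band_weight (1/2) 4 (1/6) 3)" by simp
  also have "\<dots> = (3/2) ^ (?e1 + 4) * 2 ^ (?e2 + 4) * 2 ^ (?e3 + 4) * 3 ^ (?e4 + 4) *
      aztec_sum (m + 5 * 4) (band_weight 3 (2/3) (1/2) 1)"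
    by (rule sweep[where c = 1]) (simp_all add: power2_eq_square)
  also have "aztec_sum (m + 5 * 4) (band_weight 3 (2/3) (1/2) 1 :: _ \<Rightarrow> rat) =
      aztec_sum (m + 5 * Suc 3) (band_weight 3 (2/3) (1/2) 1)" by simp
  also have "\<dots> = (3/2) ^ (?e1 + 3) * 3 ^ (?e2 + 3) * (3/2) ^ (?e3 + 3) * 2 ^ (?e4 + 3) *
      aztec_sum (m + 5 * 3) (band_weight 2 (1/2) (1/2) 2)"
    by (rule sweep[where c = 3]) (simp_all add: power2_eq_square)
  also have "aztec_sum (m + 5 * 3) (band_weight 2 (1/2) (1/2) 2 :: _ \<Rightarrow> rat) =
      aztec_sum (m + 5 * Suc 2) (band_weight 2 (1/2) (1/2) 2)" by simp
  also have "\<dots> = 2 ^ (?e1 + 2) * 3 ^ (?e2 + 2) * (3/2) ^ (?e3 + 2) * (3/2) ^ (?e4 + 2) *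
      aztec_sum (m + 5 * 2) (band_weight 1 (1/2) (2/3) 3)"
    by (rule sweep[where c = 3]) (simp_all add: power2_eq_square)
  also have "aztec_sum (m + 5 * 2) (band_weight 1 (1/2) (2/3) 3 :: _ \<Rightarrow> rat) =
      aztec_sum (m + 5 * Suc 1) (band_weight 1 (1/2) (2/3) 3)" by simp
  also have "\<dots> = 3 ^ (?e1 + 1) * 2 ^ (?e2 + 1) * 2 ^ (?e3 + 1) * (3/2) ^ (?e4 + 1) *
      aztec_sum (m + 5 * 1) (band_weight 3 (1/6) 4 (1/2))"
    by (rule sweep[where c = 1]) (simp_all add: power2_eq_square)
  also have "aztec_sum (m + 5 * 1) (band_weight 3 (1/6) 4 (1/2) :: _ \<Rightarrow> rat) =
      aztec_sum (m + 5 * Suc 0) (band_weight 3 (1/6) 4 (1/2))" by simp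
  also have "\<dots> = 3 ^ (?e1 + 0) * (3/2) ^ (?e2 + 0) * 3 ^ (?e3 + 0) * 2 ^ (?e4 + 0) *
      aztec_sum (m + 5 * 0) (band_weight 1 1 1 1)"
    by (rule sweep[where c = 3]) (simp_all add: power2_eq_square)
  finally have eq: "aztec_sum (m + 30) (band_weight 1 1 1 1 :: _ \<Rightarrow> rat) =
     2 ^ (?e1 + 5) * (3/2) ^ (?e2 + 5) * 3 ^ (?e3 + 5) * 3 ^ (?e4 + 5) *
     ((3/2) ^ (?e1 + 4) * 2 ^ (?e2 + 4) * 2 ^ (?e3 + 4) * 3 ^ (?e4 + 4) *
     ((3/2) ^ (?e1 + 3) * 3 ^ (?e2 + 3) * (3/2) ^ (?e3 + 3) * 2 ^ (?e4 + 3) *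
     (2 ^ (?e1 + 2) * 3 ^ (?e2 + 2) * (3/2) ^ (?e3 + 2) * (3/2) ^ (?e4 + 2) *
     (3 ^ (?e1 + 1) * 2 ^ (?e2 + 1) * 2 ^ (?e3 + 1) * (3/2) ^ (?e4 + 1) *
     (3 ^ (?e1 + 0) * (3/2) ^ (?e2 + 0) * 3 ^ (?e3 + 0) * 2 ^ (?e4 + 0) *
      aztec_sum m (band_weight 1 1 1 1))))))"
    by simp
  \<comment> \<open>Each of the four factors takes the values \<open>2\<close>, \<open>3/2\<close>
    and \<open>3\<close> twice over the six sweeps, which gives \<open>81\<close>. The offsets 5 to
    0 contribute \<open>3 ^ (8 + 10 + 10 + 12)\<close>, that is \<open>81 ^ 10\<close>.\<close>
  have gather: "2 ^ e * (3/2) ^ e * (3/2) ^ e * 2 ^ e * 3 ^ e * 3 ^ e = (81 :: rat) ^ e" for e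
    by (simp flip: power_mult_distrib)
  show ?thesis
    unfolding eq sweep_exponent_def power_add gather[symmetric] by (simp, simp add: power_divide)
qed

section \<open>Perfect matchings of the graphs \<open>B\<^sub>n\<close>\<close>

text \<open>Since every edge lies inside \<open>X\<close>, a unique chosen edge at each vertex of
  \<open>X\<close> amounts to disjointness plus full union; injectivity of \<open>f\<close> lets
  edges be replaced by their indices.\<close>

lemma perfect_matching_image:
  assumes "inj_on f E" "N \<subseteq> E" "\<And>e. e \<in> E \<Longrightarrow> f e \<subseteq> X"
  shows "perfect_matching (X, f ` E) (f ` N) \<longleftrightarrow> covers f N X"
proof -
  have inj: "f e = f e' \<longleftrightarrow> e = e'" if "e \<in> N" "e' \<in> N" for e e'
    using that assms(1,2) by (meson inj_on_eq_iff subsetD)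
  have "(\<exists>!e. e \<in> f ` N \<and> v \<in> e) \<longleftrightarrow> (\<exists>!e. e \<in> N \<and> v \<in> f e)" for v
  proof
    assume "\<exists>!e. e \<in> f ` N \<and> v \<in> e"
    then obtain y where y: "y \<in> f ` N" "v \<in> y" and uniq: "\<And>e'. e' \<in> f ` N \<Longrightarrow> v \<in> e' \<Longrightarrow> e' = y"
      by (elim ex1E) auto
    from y(1) obtain e where e: "e \<in> N" "y = f e" by blast
    show "\<exists>!e. e \<in> N \<and> v \<in> f e"
    proof (rule ex1I[of _ e])
      show "e \<in> N \<and> v \<in> f e" using e y by simp
    next
      fix e' assume e': "e' \<in> N \<and> v \<in> f e'"
      then have "f e' = f e" using uniq[of "f e'"] e(2) by simp
      then show "e' = e" using inj[of e' e] e' e(1) by simp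
    qed
  next
    assume "\<exists>!e. e \<in> N \<and> v \<in> f e"
    then obtain e where e: "e \<in> N" "v \<in> f e" and uniq: "\<And>e'. e' \<in> N \<Longrightarrow> v \<in> f e' \<Longrightarrow> e' = e"
      by (elim ex1E) auto
    show "\<exists>!e. e \<in> f ` N \<and> v \<in> e"
    proof (rule ex1I[of _ "f e"])
      show "f e \<in> f ` N \<and> v \<in> f e" using e by simp
    next
      fix y assume y: "y \<in> f ` N \<and> v \<in> y"
      then obtain e' where "e' \<in> N" "y = f e'" by blast
      then show "y = f e" using uniq[of e'] y by simp
    qed
  qed
  then have "(\<forall>v\<in>X. \<exists>!e. e \<in> f ` N \<and> v \<in> e) \<longleftrightarrow> (\<forall>v\<in>X. \<exists>!e. e \<in> N \<and> v \<in> f e)" by simp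
  also have "\<dots> \<longleftrightarrow> covers f N X"
  proof
    assume *: "\<forall>v\<in>X. \<exists>!e. e \<in> N \<and> v \<in> f e"
    have sub: "(\<Union>e\<in>N. f e) \<subseteq> X" using assms(2,3) by blast
    have "f e \<inter> f e' = {}" if e: "e \<in> N" "e' \<in> N" "e \<noteq> e'" for e e'
    proof (rule ccontr)
      assume "f e \<inter> f e' \<noteq> {}"
      then obtain v where v: "v \<in> f e" "v \<in> f e'" by blast
      then have "v \<in> X" using sub e(1) by blast
      from bspec[OF * this] obtain z where "\<And>d. d \<in> N \<Longrightarrow> v \<in> f d \<Longrightarrow> d = z" by (elim ex1E) auto
      from this[OF e(1) v(1)] this[OF e(2) v(2)] e(3) show False by simp
    qed
    moreover have "v \<in> (\<Union>e\<in>N. f e)" if "v \<in> X" for v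
      using ex1_implies_ex[OF bspec[OF * that]] by blast
    ultimately show "covers f N X"
      unfolding covers_def disjoint_family_on_def using sub by blast
  next
    assume c: "covers f N X"
    show "\<forall>v\<in>X. \<exists>!e. e \<in> N \<and> v \<in> f e"
    proof
      fix v assume "v \<in> X"
      then obtain e where e: "e \<in> N" "v \<in> f e" using c unfolding covers_def by blast
      show "\<exists>!e. e \<in> N \<and> v \<in> f e"
      proof (rule ex1I[of _ e])
        fix e' assume "e' \<in> N \<and> v \<in> f e'"
        then show "e' = e" using c e unfolding covers_def disjoint_family_on_def by blast
      qed (use e in simp)
    qed
  qed
  finally show ?thesis using image_mono[OF assms(2), of f] by (simp add: perfect_matching_def)
qed

text \<open>A product of 0-1 weights is the indicator that all edges of \<open>N\<close> satisfy
  \<open>P\<close>, so the weighted sum counts matchings.\<close>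

lemma num_perfect_matchings_eq_matching_sum:
  assumes "finite E" "inj_on f E" "\<And>e. e \<in> E \<Longrightarrow> f e \<subseteq> X"
    and "\<And>e. e \<in> E \<Longrightarrow> w e = of_bool (P e)"
  shows "of_nat (num_perfect_matchings (X, f ` {e \<in> E. P e})) = matching_sum f E X w"
proof -
  let ?E = "{e \<in> E. P e}"
  have inj: "inj_on f ?E" using assms(2) by (rule inj_on_subset) auto
  have "{M. perfect_matching (X, f ` ?E) M} = (`) f ` {N. N \<subseteq> ?E \<and> covers f N X}"
  proof (intro equalityI subsetI)
    fix M assume "M \<in> {M. perfect_matching (X, f ` ?E) M}"
    then have "perfect_matching (X, f ` ?E) M" "M \<subseteq> f ` ?E"
      by (auto simp: perfect_matching_def)
    then obtain N where "N \<subseteq> ?E" "M = f ` N" by (auto simp: subset_image_iff)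
    then show "M \<in> (`) f ` {N. N \<subseteq> ?E \<and> covers f N X}"
      using \<open>perfect_matching (X, f ` ?E) M\<close> perfect_matching_image[OF inj, of N X] assms(3) by auto
  next
    fix M assume "M \<in> (`) f ` {N. N \<subseteq> ?E \<and> covers f N X}"
    then show "M \<in> {M. perfect_matching (X, f ` ?E) M}"
      using perfect_matching_image[OF inj, of _ X] assms(3) by auto
  qed
  moreover have "inj_on ((`) f) {N. N \<subseteq> ?E \<and> covers f N X}"
    using inj by (auto intro!: inj_onI dest: inj_on_image_eq_iff)
  ultimately have "num_perfect_matchings (X, f ` ?E) = card {N. N \<subseteq> ?E \<and> covers f N X}"
    by (simp add: num_perfect_matchings_def card_image)
  moreover have "matching_sum f E X w = (\<Sum>N | N \<subseteq> E \<and> covers f N X. of_bool (N \<subseteq> ?E))"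
    unfolding matching_sum_def
  proof (rule sum.cong[OF refl])
    fix N assume N: "N \<in> {N. N \<subseteq> E \<and> covers f N X}"
    then have "finite N" using assms(1) finite_subset by blast
    have "(\<Prod>e\<in>N. w e) = (\<Prod>e\<in>N. of_bool (P e))"
      using N assms(4) by (intro prod.cong) auto
    also have "\<dots> = of_bool (N \<subseteq> ?E)"
    proof (cases "N \<subseteq> ?E")
      case True
      then show ?thesis by (auto intro!: prod.neutral)
    next
      case False
      then have "\<exists>e\<in>N. \<not> P e" using N by auto
      then show ?thesis using \<open>finite N\<close> False by (auto intro!: prod_zero)
    qed
    finally show "(\<Prod>e\<in>N. w e) = of_bool (N \<subseteq> ?E)" .
  qed
  moreover have "{N. N \<subseteq> E \<and> covers f N X} \<inter> {N. N \<subseteq> ?E} = {N. N \<subseteq> ?E \<and> covers f N X}" by auto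
  moreover have "finite {N. N \<subseteq> E \<and> covers f N X}"
    using assms(1) by (auto intro: finite_subset[of _ "Pow E"])
  ultimately show ?thesis by (simp add: sum.If_cases of_bool_def)
qed

lemma inj_aztec_ends: "inj aztec_ends"
proof (rule injI, clarify)
  fix r s r' s' assume "aztec_edge r s = aztec_edge r' s'"
  then have "r div 2 = r' div 2" "(r + 1) div 2 = (r' + 1) div 2"
    "s div 2 = s' div 2" "(s + 1) div 2 = (s' + 1) div 2"
    by (auto simp: aztec_edge_def doubleton_eq_iff)
  then show "r = r' \<and> s = s'" by (auto dest: aztec_index_eq)
qed

section \<open>The matrix as a periodic pattern on cells\<close>

definition band :: "nat \<Rightarrow> nat \<Rightarrow> bool" where
  "band r s = (let t = ((r + 1) div 2 + (s + 1) div 2) mod 10 in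
     if odd r \<and> odd s then t < 4 else if even r \<and> even s then 4 \<le> t \<and> t < 8 else True)"

text \<open>A finite check of all 400 entries; it shows that presence of an edge depends on its
  place in the cell and on \<open>i + j\<close> modulo 10.\<close>

lemma A_rows_band:
  "A_rows = map (\<lambda>r. map (\<lambda>s. of_bool (band (r + 1) (s + 1))) [0..<20]) [0..<20]"
proof -
  have upt: "[0..<20] = [0, 1, 2, 3, 4, 5, 6, 7, 8, 9, 10, 11, 12, 13, 14, 15, 16, 17, 18, 19]"
    by (simp add: upt_rec)
  show ?thesis
    unfolding A_rows_def upt list.map by (simp add: band_def)
qed

lemma A_entry_band:
  assumes "r \<in> {1..20}" "s \<in> {1..20}"
  shows "A_entry r s = 1 \<longleftrightarrow> band r s"
proof -
  have "A_entry r s = of_bool (band r s)"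
    using assms unfolding A_entry_def A_rows_band by auto
  then show ?thesis by simp
qed

text \<open>A shift by 20 keeps the parity and moves the cell coordinate by 10.\<close>

lemma band_mod: "band (r mod 20) (s mod 20) = band r s"
proof -
  have par: "even (r mod 20) = even r" for r :: nat by presburger
  have half: "(r mod 20 + 1) div 2 mod 10 = (r + 1) div 2 mod 10" for r :: nat
  proof -
    have "(20 * a + b + 1) div 2 = 10 * a + (b + 1) div 2" for a b :: nat by presburger
    from this[of "r div 20" "r mod 20"] have "(r + 1) div 2 = 10 * (r div 20) + (r mod 20 + 1) div 2"
      by (simp only: mult_div_mod_eq)
    then show ?thesis by simp
  qed
  have "((r mod 20 + 1) div 2 + (s mod 20 + 1) div 2) mod 10 = ((r + 1) div 2 + (s + 1) div 2) mod 10"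
    using half by (rule mod_add_cong) (rule half)
  then show ?thesis unfolding band_def by (simp only: par)
qed

lemma B_graph_band: "B_graph n =
  (aztec_vertices n, aztec_ends ` {e \<in> {1..2 * n} \<times> {1..2 * n}. case_prod band e})"
proof -
  have "(\<exists>r'\<in>{1..20}. \<exists>s'\<in>{1..20}. [r' = r] (mod 20) \<and> [s' = s] (mod 20) \<and> A_entry r' s' = 1) \<longleftrightarrow> band r s"
    if "1 \<le> r" "1 \<le> s" for r s
  proof
    assume "\<exists>r'\<in>{1..20}. \<exists>s'\<in>{1..20}. [r' = r] (mod 20) \<and> [s' = s] (mod 20) \<and> A_entry r' s' = 1"
    then obtain r' s' where "r' mod 20 = r mod 20" "s' mod 20 = s mod 20" "band r' s'"
      using A_entry_band by (auto simp: cong_def)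
    then show "band r s" using band_mod by metis
  next
    assume b: "band r s"
    \<comment> \<open>The representative must lie in 1 to 20, so multiples of 20 go to 20 and not to
      0.\<close>
    let ?r = "(r - 1) mod 20 + 1" and ?s = "(s - 1) mod 20 + 1"
    have c: "?r mod 20 = r mod 20" "?s mod 20 = s mod 20" using that by (simp_all add: mod_Suc_eq)
    then have "band ?r ?s" using b band_mod by metis
    moreover have "?r \<in> {1..20}" "?s \<in> {1..20}" by auto
    ultimately have "A_entry ?r ?s = 1" using A_entry_band by blast
    then show "\<exists>r'\<in>{1..20}. \<exists>s'\<in>{1..20}. [r' = r] (mod 20) \<and> [s' = s] (mod 20) \<and> A_entry r' s' = 1"
      using c \<open>?r \<in> {1..20}\<close> \<open>?s \<in> {1..20}\<close> unfolding cong_def by blast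
  qed
  note present = this
  have "snd (B_graph n) = aztec_ends ` {e \<in> {1..2 * n} \<times> {1..2 * n}. case_prod band e}"
  proof (intro equalityI subsetI)
    fix e assume "e \<in> snd (B_graph n)"
    then obtain r s where e: "e = aztec_edge r s" "r \<in> {1..2 * n}" "s \<in> {1..2 * n}"
      and A: "\<exists>r'\<in>{1..20}. \<exists>s'\<in>{1..20}. [r' = r] (mod 20) \<and> [s' = s] (mod 20) \<and> A_entry r' s' = 1"
      unfolding B_graph_def snd_conv by blast
    have "band r s" using A present[of r s] e by auto
    then have "e = aztec_ends (r, s)" "(r, s) \<in> {e \<in> {1..2 * n} \<times> {1..2 * n}. case_prod band e}"
      using e by auto
    then show "e \<in> aztec_ends ` {e \<in> {1..2 * n} \<times> {1..2 * n}. case_prod band e}" by blast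
  next
    fix e assume "e \<in> aztec_ends ` {e \<in> {1..2 * n} \<times> {1..2 * n}. case_prod band e}"
    then obtain r s where e: "e = aztec_edge r s" "r \<in> {1..2 * n}" "s \<in> {1..2 * n}" "band r s" by auto
    then show "e \<in> snd (B_graph n)"
      unfolding B_graph_def snd_conv using present[of r s] by auto
  qed
  then show ?thesis using B_graph_spanning(1)[of n] by (simp add: prod_eq_iff aztec_diamond_def)
qed

lemma band_weight_ones: "band_weight 1 1 1 1 (r, s) = of_bool (band r s)"
proof -
  have a: "periodic [1, 1, 1, 1, 0, 0, 0, 0, 0, 0 :: 'a] t = of_bool (t mod 10 < 4)"
    and d: "periodic [0, 0, 0, 0, 1, 1, 1, 1, 0, 0 :: 'a] t = of_bool (4 \<le> t mod 10 \<and> t mod 10 < 8)" for t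
  proof -
    have "k = 0 \<or> k = 1 \<or> k = 2 \<or> k = 3 \<or> k = 4 \<or> k = 5 \<or> k = 6 \<or> k = 7 \<or> k = 8 \<or> k = 9"
      if "k < 10" for k :: nat using that by presburger
    from this[of "t mod 10"] have "t mod 10 = 0 \<or> t mod 10 = 1 \<or> t mod 10 = 2 \<or> t mod 10 = 3 \<or>
      t mod 10 = 4 \<or> t mod 10 = 5 \<or> t mod 10 = 6 \<or> t mod 10 = 7 \<or> t mod 10 = 8 \<or> t mod 10 = 9"
      by simp
    then show "periodic [1, 1, 1, 1, 0, 0, 0, 0, 0, 0 :: 'a] t = of_bool (t mod 10 < 4)"
      "periodic [0, 0, 0, 0, 1, 1, 1, 1, 0, 0 :: 'a] t = of_bool (4 \<le> t mod 10 \<and> t mod 10 < 8)"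
      by (elim disjE; simp add: periodic_def)+
  qed
  \<comment> \<open>Reconciles the two forms of the cell coordinate on even-even edges.\<close>
  have "even r \<Longrightarrow> r div 2 = (r + 1) div 2" for r :: nat by presburger
  then show ?thesis
    unfolding band_weight_def diag_weight_def band_def a d by (auto simp: Let_def)
qed

lemma num_perfect_matchings_B:
  "of_nat (num_perfect_matchings (B_graph n)) = aztec_sum n (band_weight 1 1 1 1)"
  unfolding B_graph_band aztec_sum_def
proof (rule num_perfect_matchings_eq_matching_sum)
  show "inj_on aztec_ends ({1..2 * n} \<times> {1..2 * n})"
    using inj_aztec_ends by (rule inj_on_subset) simp
  show "aztec_ends e \<subseteq> aztec_vertices n" if "e \<in> {1..2 * n} \<times> {1..2 * n}" for e
  proof -
    have "aztec_ends e \<in> snd (aztec_diamond n)" using that by (force simp: aztec_diamond_def)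
    from aztec_diamond_edges_wf(1)[OF this] show ?thesis by (simp add: aztec_diamond_def)
  qed
  show "band_weight 1 1 1 1 e = of_bool (case_prod band e)" for e
    by (cases e) (simp add: band_weight_ones)
qed simp

section \<open>Comparison of the exponents\<close>

lemma x_exp_shift:
  assumes "m \<ge> 1"
  shows "x_exp (m + 30) = sweep_exponent m + 10"
proof -
  define q where "q = (m - 1) div 5"
  have "(5 * q + k + c) div 5 = q + (k + c) div 5" for k c by (simp add: add.assoc)
  then have count: "sweep_exponent (5 * q + k) =
      4 * q + ((k + 8) div 5 + (k + 3) div 5 + (k + 7) div 5 + (k + 2) div 5)" for k
    by (simp only: sweep_exponent_def)
  \<comment> \<open>Residues run from 1 to 5, matching \<open>(n - 1) div 5\<close> in
    \<open>x_exp\<close>. Adding 30 replaces \<open>q\<close> by \<open>q + 6\<close>, and both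
    sides are \<open>4 * q\<close> plus the same constant.\<close>
  have "m = 5 * q + 1 \<or> m = 5 * q + 2 \<or> m = 5 * q + 3 \<or> m = 5 * q + 4 \<or> m = 5 * q + 5"
    unfolding q_def using assms by presburger
  then consider "m = 5 * q + 1" | "m = 5 * q + 2" | "m = 5 * q + 3" | "m = 5 * q + 4" | "m = 5 * q + 5"
    by blast
  then show ?thesis
  proof cases
    case 1
    have "x_exp (m + 30) = x_exp (5 * (q + 6) + 1)" by (simp add: 1)
    then show ?thesis using x_exp_values(1)[OF le_add2, of q] count[of 1] by (simp add: 1)
  next
    case 2
    have "x_exp (m + 30) = x_exp (5 * (q + 6) + 2)" by (simp add: 2)
    then show ?thesis using x_exp_values(2)[OF le_add2, of q] count[of 2] by (simp add: 2)
  next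
    case 3
    have "x_exp (m + 30) = x_exp (5 * (q + 6) + 3)" by (simp add: 3)
    then show ?thesis using x_exp_values(3)[OF le_add2, of q] count[of 3] by (simp add: 3)
  next
    case 4
    have "x_exp (m + 30) = x_exp (5 * (q + 6) + 4)" by (simp add: 4)
    then show ?thesis using x_exp_values(4)[OF le_add2, of q] count[of 4] by (simp add: 4)
  next
    case 5
    have "x_exp (m + 30) = x_exp (5 * (q + 6) + 5)" by (simp add: 5)
    then show ?thesis using x_exp_values(5)[OF le_add2, of q] count[of 5] by (simp add: 5)
  qed
qed

theorem theorem8p1:
  fixes n :: nat
  assumes "n \<ge> 31"
  shows "num_perfect_matchings (B_graph n) =
    3 ^ (4 * x_exp n) * num_perfect_matchings (B_graph (n - 30))"
proof -
  have n: "n = n - 30 + 30" using assms by simp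
  \<comment> \<open>The identity is proved over the rationals, since the intermediate weights are
    fractions; \<open>81 = 3 ^ 4\<close> then brings it back to natural numbers.\<close>
  have "of_nat (num_perfect_matchings (B_graph n)) =
      81 ^ (x_exp n) * (of_nat (num_perfect_matchings (B_graph (n - 30))) :: rat)"
    unfolding num_perfect_matchings_B using band_return[of "n - 30"] x_exp_shift[of "n - 30"] n assms by simp
  also have "\<dots> = of_nat (3 ^ (4 * x_exp n) * num_perfect_matchings (B_graph (n - 30)))"
    by (simp add: power_mult)
  finally show ?thesis by (simp only: of_nat_eq_iff)
qed

end
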